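(* Let $n\ge 1$ and $s\ge 1$ be fixed integers. As $H\to\infty$, $$H^{sn^2-\lceil s/2\rceil n+o(1)}\ \ge\ \#\mathcal{N}^*_{n,s}(H)\ \ge\ \begin{cases}H^{(s-1)n^2/2+n/2+o(1)}, & \text{if } s \text{ is even},\\ H^{(s-1)n^2/2+o(1)}, & \text{if } s\text{ is odd}.\end{cases}$$
   Context: $\mathcal{M}_n(\mathbb{Z};H)$ is the set of $n\times n$ matrices with integer entries of absolute value at most $H$. An $s$-tuple $(A_1,\dots,A_s)$ of non-singular $n\times n$ matrices is multiplicatively dependent if there is a non-zero vector $(k_1,\dots,k_s)\in\mathbb{Z}^s$ with $A_1^{k_1}\cdots A_s^{k_s}=I_n$ (product in this order); otherwise it is multiplicatively independent. $\mathcal{N}_{n,s}(H)$ is the set of multiplicatively dependent $s$-tuples (of non-singular matrices) $(A_1,\dots,A_s)\in\mathcal{M}_n(\mathbb{Z};H)^s$. $\mathcal{N}^*_{n,s}(H)$ is the subset of those $(A_1,\dots,A_s)\in\mathcal{N}_{n,s}(H)$ such that every sub-tuple $(A_{i_1},\dots,A_{i_t})$ of length $t<s$ with $1\le i_1<\dots<i_t\le s$ is multiplicatively independent. In the exponents, $o(1)$ denotes a quantity tending to $0$ as $H\to\infty$ with $n,s$ fixed; i.e. for every $\varepsilon>0$ the bounds hold with $o(1)$ replaced by $+\varepsilon$ (upper bound), respectively $-\varepsilon$ (lower bound), for all $H\ge H_0(n,s,\varepsilon)$. *)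

theory Defs
  imports Complex_Main "Jordan_Normal_Form.Determinant"
begin

definition bounded_int_mats :: "nat \<Rightarrow> real \<Rightarrow> int mat set" where
  "bounded_int_mats n H =
     {A \<in> carrier_mat n n. \<forall>i<n. \<forall>j<n. \<bar>real_of_int (A $$ (i, j))\<bar> \<le> H}"

text \<open>
  The inverse of a non-singular integer matrix is in general only rational, so powers with
  integer exponents are taken in the group of invertible rational matrices, where
  \<open>A [^] k\<close> with \<open>k < 0\<close> is the power with exponent \<open>- k\<close> of the inverse of \<open>A\<close>.
\<close>

definition GL_rat :: "nat \<Rightarrow> rat mat monoid" where
  "GL_rat n = units_of (ring_mat TYPE(rat) n ())"

text \<open>
  Tuples are lists. The \<open>foldr\<close> forms the product from left to right,
  in the order of the tuple; the empty tuple is not dependent.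
\<close>

definition mult_dependent :: "nat \<Rightarrow> int mat list \<Rightarrow> bool" where
  "mult_dependent n As \<longleftrightarrow>
     (\<exists>ks :: int list. length ks = length As \<and> (\<exists>k \<in> set ks. k \<noteq> 0) \<and>
        foldr (\<lambda>X Y. X \<otimes>\<^bsub>GL_rat n\<^esub> Y)
          (map2 (\<lambda>A k. map_mat rat_of_int A [^]\<^bsub>GL_rat n\<^esub> k) As ks)
          \<one>\<^bsub>GL_rat n\<^esub> = 1\<^sub>m n)"

definition dependent_tuples :: "nat \<Rightarrow> nat \<Rightarrow> real \<Rightarrow> int mat list set" where
  "dependent_tuples n s H =
     {As. length As = s \<and> (\<forall>A \<in> set As. A \<in> bounded_int_mats n H \<and> det A \<noteq> 0) \<and>
          mult_dependent n As}"

text \<open>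
  \<open>nths As I\<close> is the sub-tuple of the entries with (0-based) positions in \<open>I\<close>, in their
  original order; the proper sub-tuples are those with \<open>I \<subset> {..<s}\<close>.
\<close>

definition minimal_dependent_tuples :: "nat \<Rightarrow> nat \<Rightarrow> real \<Rightarrow> int mat list set" where
  "minimal_dependent_tuples n s H =
     {As \<in> dependent_tuples n s H. \<forall>I. I \<subset> {..<s} \<longrightarrow> \<not> mult_dependent n (nths As I)}"

end

theory Submission
  imports Defs "HOL-Computational_Algebra.Primes" "HOL-Library.FuncSet"
begin

text \<open>
  Upper bound. By minimality all exponents of a relation are non-zero. Taking determinants and
  \<open>p\<close>-adic valuations, the primes dividing a determinant with positive exponent divide some
  determinant with negative exponent, and vice versa. Choose freely the matrices at the set \<open>J\<close> of
  positions carrying the rarer sign, so \<open>2 * card J \<le> s\<close>. Every other determinant is then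
  composed of the primes of one fixed non-zero integer of polynomial size, which leaves
  \<open>H powr o(1)\<close> values (Rankin's trick), and each value \<open>d \<noteq> 0\<close> is the determinant of at
  most \<open>H powr (n\<^sup>2 - n + o(1))\<close> matrices. For the last fact, let \<open>c\<close> be the primitive vector
  orthogonal to all columns but the first. A hyperplane \<open>c \<bullet> x = e\<close> contains at most
  \<open>O(H ^ (n - 1) / \<parallel>c\<parallel>)\<close> integer points of the box, because \<open>\<parallel>c\<parallel> * H\<close> disjoint
  translates of this set fit into a box of size \<open>O(H)\<close>; and the sum of \<open>1 / \<parallel>c\<parallel> ^ n\<close> over all
  possible \<open>c\<close> is only logarithmic.

  Lower bound. Pairs \<open>Z, p \<cdot>\<^sub>m Z\<close> have a scalar quotient whatever \<open>Z\<close> is, so half of the matrices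
  can be chosen freely, and the end of the tuple cancels the product of the scalars. Congruence
  conditions on the \<open>Z\<close> make determinants alone exclude relations of proper sub-tuples.
\<close>

section \<open>Integer points in boxes and slabs\<close>

text \<open>Necessary conditions on a relation are always read off determinants, so it does not
  matter that the matrices need not commute: each prime contributes one linear equation between
  valuations. The exponents of a relation are unbounded; the upper bound therefore forgets them and
  keeps only which primes divide which determinants. At least \<open>\<lceil>s / 2\<rceil>\<close>
  positions lie outside \<open>J\<close>, and each of them loses a factor of about
  \<open>H ^ n\<close>; this is the origin of the subtracted term. In the lower bound the obstacle
  is minimality: the valuation equations must leave only the multiples of one exponent vector
  without zero entries. The prime \<open>q j\<close> ties the two members of a pair to each other,
  and \<open>p j\<close> ties pair \<open>j\<close> to the place where \<open>P\<close> stands. The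
  \<open>p j\<close>-adic valuations of the \<open>det (Z i)\<close> are uncontrolled, so the
  equations at the \<open>q j\<close> have to come first and cancel them. The resulting exponent is
  \<open>n\<^sup>2 * (s div 2)\<close>, which is at least the required one.\<close>

definition int_box :: "nat \<Rightarrow> nat \<Rightarrow> int vec set" where
  "int_box n h = {v \<in> carrier_vec n. \<forall>i<n. \<bar>v $ i\<bar> \<le> int h}"

lemma bij_betw_vec_PiE:
  "bij_betw (vec n) (Pi\<^sub>E {..<n} S) {v \<in> carrier_vec n. \<forall>i<n. v $ i \<in> S i}"
proof (rule bij_betwI[where g = "\<lambda>v. restrict (\<lambda>i. v $ i) {..<n}"])
  show "vec n \<in> Pi\<^sub>E {..<n} S \<rightarrow> {v \<in> carrier_vec n. \<forall>i<n. v $ i \<in> S i}"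
    by (auto simp: PiE_def Pi_def)
  show "(\<lambda>v. restrict (\<lambda>i. v $ i) {..<n}) \<in> {v \<in> carrier_vec n. \<forall>i<n. v $ i \<in> S i} \<rightarrow> Pi\<^sub>E {..<n} S"
    by auto
  fix f assume "f \<in> Pi\<^sub>E {..<n} S"
  then show "restrict (\<lambda>i. vec n f $ i) {..<n} = f"
    by (auto simp: fun_eq_iff PiE_def extensional_def)
next
  fix v assume "v \<in> {v \<in> carrier_vec n. \<forall>i<n. v $ i \<in> S i}"
  then show "vec n (restrict (\<lambda>i. v $ i) {..<n}) = v"
    by auto
qed

lemma int_box_eq: "int_box n h = {v \<in> carrier_vec n. \<forall>i<n. v $ i \<in> {- int h..int h}}"
  by (auto simp: int_box_def abs_le_iff)

lemma finite_int_box: "finite (int_box n h)"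
  unfolding int_box_eq
  using bij_betw_finite[OF bij_betw_vec_PiE, of n "\<lambda>_. {- int h..int h}"] by (simp add: finite_PiE)

lemma card_int_box: "card (int_box n h) = (2 * h + 1) ^ n"
proof -
  have "card (int_box n h) = card (Pi\<^sub>E {..<n} (\<lambda>_. {- int h..int h}))"
    unfolding int_box_eq by (rule bij_betw_same_card[OF bij_betw_vec_PiE, symmetric])
  then show ?thesis by (simp add: card_PiE nat_add_distrib nat_mult_distrib algebra_simps)
qed

lemma sum_int_box_prod:
  fixes f :: "int \<Rightarrow> 'a :: comm_semiring_1"
  shows "(\<Sum>v\<in>int_box n h. \<Prod>i<n. f (v $ i)) = (\<Sum>t\<in>{- int h..int h}. f t) ^ n"
proof -
  have "(\<Sum>v\<in>int_box n h. \<Prod>i<n. f (v $ i)) =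
      (\<Sum>g\<in>Pi\<^sub>E {..<n} (\<lambda>_. {- int h..int h}). \<Prod>i<n. f (vec n g $ i))"
    unfolding int_box_eq
    by (rule sum.reindex_bij_betw[symmetric, OF bij_betw_vec_PiE])
  also have "\<dots> = (\<Sum>g\<in>Pi\<^sub>E {..<n} (\<lambda>_. {- int h..int h}). \<Prod>i<n. f (g i))"
    by (intro sum.cong prod.cong) auto
  also have "\<dots> = (\<Prod>i<n. \<Sum>t\<in>{- int h..int h}. f t)"
    by (subst prod_sum_PiE) auto
  finally show ?thesis by simp
qed

lemma finite_card_mat_cols:
  fixes S :: "nat \<Rightarrow> 'a vec set"
  assumes "\<And>j. j < n \<Longrightarrow> finite (S j)"
  shows "finite {A \<in> carrier_mat m n. \<forall>j<n. col A j \<in> S j}"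
    and "card {A \<in> carrier_mat m n. \<forall>j<n. col A j \<in> S j} \<le> (\<Prod>j<n. card (S j))"
proof -
  let ?F = "\<lambda>A. restrict (col A) {..<n}" and ?T = "{A \<in> carrier_mat m n. \<forall>j<n. col A j \<in> S j}"
  have inj: "inj_on ?F ?T"
  proof (rule inj_onI)
    fix A B :: "'a mat"
    assume A: "A \<in> ?T" and B: "B \<in> ?T" and eq: "?F A = ?F B"
    have "col A j = col B j" if "j < n" for j
      using fun_cong[OF eq, of j] that by simp
    then show "A = B" using A B by (intro mat_col_eqI) auto
  qed
  have img: "?F ` ?T \<subseteq> Pi\<^sub>E {..<n} S" by auto
  have fin: "finite (Pi\<^sub>E {..<n} S)" using assms by (intro finite_PiE) auto
  show "finite ?T" using finite_imageD[OF finite_subset[OF img fin] inj] .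
  show "card ?T \<le> (\<Prod>j<n. card (S j))"
    using card_inj_on_le[OF inj img fin] by (simp add: card_PiE)
qed

text \<open>Cramer's rule with rounding. The rational solution of \<open>N x = y\<close> is
  \<open>w / D\<close> with \<open>w = adj_mat N *\<^sub>v y\<close>. Rounding its coordinates down
  gives \<open>u\<close> and leaves \<open>D z = N r\<close> with remainders smaller than
  \<open>|D|\<close>, so a coordinate of \<open>z\<close> is a sum of \<open>n\<close> terms of size
  at most \<open>h\<close>.\<close>

lemma lattice_reduction:
  fixes N :: "int mat"
  assumes N: "N \<in> carrier_mat n n" and d: "det N \<noteq> 0"
    and bd: "\<And>i j. i < n \<Longrightarrow> j < n \<Longrightarrow> \<bar>N $$ (i, j)\<bar> \<le> h" and y: "y \<in> carrier_vec n"
  obtains u z where "u \<in> carrier_vec n" "z \<in> carrier_vec n" "y = z + N *\<^sub>v u"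
    "\<And>i. i < n \<Longrightarrow> \<bar>z $ i\<bar> \<le> int n * h"
proof
  define D where "D = det N"
  define w where "w = adj_mat N *\<^sub>v y"
  define u where "u = vec n (\<lambda>i. w $ i div D)"
  define r where "r = vec n (\<lambda>i. w $ i mod D)"
  define z where "z = y - N *\<^sub>v u"
  have w: "w \<in> carrier_vec n" using adj_mat(1)[OF N] y by (simp add: w_def)
  show u: "u \<in> carrier_vec n" and z: "z \<in> carrier_vec n" 
    using N y by (auto simp: u_def z_def)
  have r: "r \<in> carrier_vec n" by (simp add: r_def)
  have Nw: "N *\<^sub>v w = D \<cdot>\<^sub>v y"
  proof -
    have "N *\<^sub>v w = (N * adj_mat N) *\<^sub>v y"
      using N adj_mat(1)[OF N] y by (simp add: w_def)
    also have "\<dots> = D \<cdot>\<^sub>v y" 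
      unfolding adj_mat(2)[OF N] D_def using y
      by (intro eq_vecI) (auto simp: scalar_prod_def mult.assoc if_distrib[of "\<lambda>x. x * y $ _"]
          sum_distrib_left[symmetric] cong: if_cong)
    finally show ?thesis .
  qed
  show "y = z + N *\<^sub>v u" using N y u by (auto simp: z_def)
  have wr: "w = D \<cdot>\<^sub>v u + r" using w by (auto simp: u_def r_def)
  have Dz: "D \<cdot>\<^sub>v z = N *\<^sub>v r"
  proof -
    have "N *\<^sub>v w = D \<cdot>\<^sub>v (N *\<^sub>v u) + N *\<^sub>v r"
      unfolding wr using N u r 
      by (subst mult_add_distrib_mat_vec[of _ n n]) (auto simp: mult_mat_vec[of _ n n])
    then have e: "D \<cdot>\<^sub>v y = D \<cdot>\<^sub>v (N *\<^sub>v u) + N *\<^sub>v r" using Nw by simp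
    show ?thesis
    proof (rule eq_vecI)
      fix i assume i: "i < dim_vec (N *\<^sub>v r)"
      then have "i < n" using N by simp
      have "(D \<cdot>\<^sub>v y) $ i = (D \<cdot>\<^sub>v (N *\<^sub>v u) + N *\<^sub>v r) $ i" using e by simp
      then show "(D \<cdot>\<^sub>v z) $ i = (N *\<^sub>v r) $ i"
        using \<open>i < n\<close> N y u r by (simp add: z_def algebra_simps del: index_mult_mat_vec)
    qed (use N y in \<open>auto simp: z_def\<close>)
  qed
  fix i assume i: "i < n"
  have D0: "D \<noteq> 0" using d by (simp add: D_def)
  have "\<bar>D\<bar> * \<bar>z $ i\<bar> = \<bar>(D \<cdot>\<^sub>v z) $ i\<bar>" using z i by (simp add: abs_mult)
  also have "\<dots> = \<bar>\<Sum>j<n. N $$ (i, j) * (w $ j mod D)\<bar>"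
    unfolding Dz using N i by (simp add: scalar_prod_def r_def lessThan_atLeast0)
  also have "\<dots> \<le> (\<Sum>j<n. \<bar>N $$ (i, j)\<bar> * \<bar>w $ j mod D\<bar>)"
    by (rule order.trans[OF sum_abs]) (simp add: abs_mult)
  also have "\<dots> \<le> (\<Sum>j<n. h * \<bar>D\<bar>)"
  proof (rule sum_mono)
    fix j assume "j \<in> {..<n}"
    then have "\<bar>N $$ (i, j)\<bar> \<le> h" using bd i by simp
    moreover have "\<bar>w $ j mod D\<bar> \<le> \<bar>D\<bar>" using abs_mod_less[OF D0, of "w $ j"] by simp
    ultimately show "\<bar>N $$ (i, j)\<bar> * \<bar>w $ j mod D\<bar> \<le> h * \<bar>D\<bar>"
      by (intro mult_mono) auto
  qed
  also have "\<dots> = \<bar>D\<bar> * (int n * h)" by simp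
  finally show "\<bar>z $ i\<bar> \<le> int n * h" using D0 by simp
qed

text \<open>The vector \<open>u\<close> certifies that \<open>c\<close> is primitive, so every
  integer is a value of \<open>c\<close>; by \<open>dvd\<close>, the lattice of \<open>N\<close>
  takes values in the multiples of \<open>c $ m\<close>. Reducing modulo this lattice preserves the
  level modulo \<open>c $ m\<close>, so each residue is attained by a vector with entries at most
  \<open>n * h\<close>. Such vectors supply the disjoint translates; they all fit into the box of
  radius \<open>(n + 2) * h\<close>, whence \<open>2 * n + 5\<close>.\<close>

lemma card_slab:
  fixes N :: "int mat" and c :: "int vec"
  assumes N: "N \<in> carrier_mat n n" and d: "det N \<noteq> 0"
    and bd: "\<And>i j. i < n \<Longrightarrow> j < n \<Longrightarrow> \<bar>N $$ (i, j)\<bar> \<le> int h" and h: "h \<ge> 1"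
    and c: "c \<in> carrier_vec n" and u: "u \<in> carrier_vec n" "c \<bullet> u = 1"
    and m: "m < n" "c $ m \<noteq> 0"
    and dvd: "\<And>j. j < n \<Longrightarrow> c $ m dvd col N j \<bullet> c"
  shows "card {x \<in> int_box n h. c \<bullet> x = e} * (nat \<bar>c $ m\<bar> * h) \<le> ((2 * n + 5) * h) ^ n"
proof -
  define q where "q = \<bar>c $ m\<bar>"
  define L where "L = {x \<in> int_box n h. c \<bullet> x = e}"
  have q: "q > 0" using m by (simp add: q_def)
  have "\<exists>z \<in> carrier_vec n. (\<forall>i<n. \<bar>z $ i\<bar> \<le> int n * int h) \<and> q dvd c \<bullet> z - t" for t
  proof -
    have tu: "t \<cdot>\<^sub>v u \<in> carrier_vec n" using u by simp
    obtain v z where vz: "v \<in> carrier_vec n" "z \<in> carrier_vec n" "t \<cdot>\<^sub>v u = z + N *\<^sub>v v"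
      "\<And>i. i < n \<Longrightarrow> \<bar>z $ i\<bar> \<le> int n * int h"
      using lattice_reduction[OF N d bd tu] by blast
    have "c \<bullet> (t \<cdot>\<^sub>v u) = t" using u c by simp
    moreover have "c \<bullet> (t \<cdot>\<^sub>v u) = c \<bullet> z + c \<bullet> (N *\<^sub>v v)"
      using vz N c by (simp add: scalar_prod_add_distrib[of _ n])
    moreover have "c \<bullet> (N *\<^sub>v v) = (N\<^sup>T *\<^sub>v c) \<bullet> v"
      using transpose_vec_mult_scalar[OF N vz(1) c] by simp
    moreover have "q dvd (N\<^sup>T *\<^sub>v c) \<bullet> v"
      unfolding scalar_prod_def q_def using N vz(1) dvd by (intro dvd_sum) auto
    ultimately have "q dvd c \<bullet> z - t" by (metis add_diff_cancel_left' dvd_minus_iff minus_diff_eq)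
    then show ?thesis using vz by blast
  qed
  then obtain Y where Y: "\<And>t. Y t \<in> carrier_vec n" "\<And>t i. i < n \<Longrightarrow> \<bar>Y t $ i\<bar> \<le> int n * int h"
    "\<And>t. q dvd c \<bullet> Y t - t" by metis
  \<comment> \<open>\<open>Y t\<close> fixes the residue of the level modulo \<open>q\<close>, and
    \<open>k\<close> moves the level inside its residue class in steps of \<open>c $ m\<close>.
    Different \<open>(t, k)\<close> thus give different levels, which makes the translates
    disjoint.\<close>
  define F where "F = (\<lambda>(x, t, k :: int). x + Y t + k \<cdot>\<^sub>v unit_vec n m)"
  define P where "P = L \<times> {0..<q} \<times> {0..<int h}"
  have cF: "c \<bullet> F (x, t, k) = e + c \<bullet> Y t + k * c $ m" if "x \<in> L" for x t k
    using that c m Y(1)[of t]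
    by (simp add: F_def L_def int_box_def scalar_prod_add_distrib[of _ n])
  have inj: "inj_on F P"
  proof (rule inj_onI)
    fix p p'
    assume p: "p \<in> P" "p' \<in> P" "F p = F p'"
    obtain x t k x' t' k' where pe: "p = (x, t, k)" "p' = (x', t', k')"
      by (cases p, cases p') auto
    have x: "x \<in> L" "x' \<in> L" and t: "0 \<le> t" "t < q" "0 \<le> t'" "t' < q"
      and eq: "F (x, t, k) = F (x', t', k')"
      using p by (auto simp: pe P_def)
    have e1: "c \<bullet> Y t + k * c $ m = c \<bullet> Y t' + k' * c $ m"
      using cF[OF x(1), of t k] cF[OF x(2), of t' k'] eq by simp
    have "t' - t = (c \<bullet> Y t - t) - (c \<bullet> Y t' - t') - (k' - k) * c $ m"
      using e1 by (simp add: algebra_simps)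
    moreover have "q dvd (c \<bullet> Y t - t) - (c \<bullet> Y t' - t') - (k' - k) * c $ m"
      by (rule dvd_diff[OF dvd_diff[OF Y(3) Y(3)] dvd_mult]) (simp add: q_def)
    ultimately have "q dvd t' - t" by metis
    then have "t' mod q = t mod q" by (simp add: mod_eq_dvd_iff)
    then have tt: "t = t'" using t by simp
    then have kk: "k = k'" using e1 m by simp
    have "x = x'"
    proof (rule eq_vecI)
      fix i assume "i < dim_vec x'"
      then have i: "i < n" using x by (auto simp: L_def int_box_def)
      have "F (x, t, k) $ i = F (x', t', k') $ i" using eq by simp
      then show "x $ i = x' $ i" using i x Y(1)[of t'] tt kk
        by (auto simp: F_def L_def int_box_def)
    qed (use x in \<open>auto simp: L_def int_box_def\<close>)
    then show "p = p'" using tt kk by (simp add: pe)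
  qed
  have img: "F ` P \<subseteq> int_box n ((n + 2) * h)"
  proof (rule image_subsetI)
    fix p assume p: "p \<in> P"
    obtain x t k where pe: "p = (x, t, k)" by (cases p) auto
    then have x: "x \<in> L" and k: "0 \<le> k" "k < int h" using p by (auto simp: P_def)
    have "\<bar>F (x, t, k) $ i\<bar> \<le> int ((n + 2) * h)" if i: "i < n" for i
    proof -
      have "F (x, t, k) $ i = x $ i + Y t $ i + k * (if i = m then 1 else 0)"
        using x i m Y(1)[of t] by (auto simp: F_def L_def int_box_def)
      moreover have "\<bar>x $ i\<bar> \<le> int h" using x i by (simp add: L_def int_box_def)
      moreover have "\<bar>k * (if i = m then 1 else 0)\<bar> \<le> int h" using k by simp
      ultimately have "\<bar>F (x, t, k) $ i\<bar> \<le> int h + int n * int h + int h"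
        using Y(2)[OF i, of t] by linarith
      then show ?thesis by (simp add: algebra_simps)
    qed
    moreover have "F (x, t, k) \<in> carrier_vec n" using x Y(1)[of t] by (simp add: F_def L_def int_box_def)
    ultimately show "F p \<in> int_box n ((n + 2) * h)" by (simp add: int_box_def pe)
  qed
  have "card P \<le> (2 * ((n + 2) * h) + 1) ^ n"
    using card_inj_on_le[OF inj img finite_int_box] by (simp add: card_int_box)
  also have "\<dots> \<le> ((2 * n + 5) * h) ^ n"
    using h by (intro power_mono) (auto simp: algebra_simps)
  finally show ?thesis by (simp add: P_def card_cartesian_product L_def q_def)
qed

section \<open>Integers composed of given primes\<close>

lemma card_smooth_step:
  fixes p X :: nat
  assumes p: "prime p"
  shows "card {m. 0 < m \<and> m \<le> X \<and> prime_factors m \<subseteq> insert p P} \<le>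
    card {m. 0 < m \<and> m \<le> X \<and> prime_factors m \<subseteq> P} +
    card {m. 0 < m \<and> m \<le> X div p \<and> prime_factors m \<subseteq> insert p P}"
    (is "card ?A \<le> card ?B + card ?C")
proof -
  have fin: "finite ?B" "finite ?C" 
    by (auto intro: finite_subset[of _ "{..X}"] finite_subset[of _ "{..X div p}"])
  have "?A \<subseteq> ?B \<union> (*) p ` ?C"
  proof
    fix m assume m: "m \<in> ?A"
    show "m \<in> ?B \<union> (*) p ` ?C"
    proof (cases "p dvd m")
      case True
      then obtain k where k: "m = p * k" by blast
      have "prime_factors k \<subseteq> prime_factors m" using m k by (intro dvd_prime_factors) auto
      moreover have "k \<le> X div p" using m k p
        by (simp add: less_eq_div_iff_mult_less_eq prime_gt_0_nat mult.commute)
      ultimately have "k \<in> ?C" using m k by auto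
      then show ?thesis using k by blast
    next
      case False
      then show ?thesis using m by (auto simp: prime_factors_dvd)
    qed
  qed
  then have "card ?A \<le> card (?B \<union> (*) p ` ?C)" using fin by (intro card_mono) auto
  also have "\<dots> \<le> card ?B + card ?C"
    by (rule order.trans[OF card_Un_le]) (simp add: card_image_le fin)
  finally show ?thesis .
qed

text \<open>Rankin's bound with the Euler product built one prime at a time: for a new prime
  \<open>p\<close>, splitting by divisibility by \<open>p\<close> gives a recursion from
  \<open>X\<close> to \<open>X div p\<close>, solved by an inner induction on
  \<open>X\<close>.\<close>

lemma card_smooth_le_prod:
  fixes P :: "nat set"
  assumes "finite P" "\<And>p. p \<in> P \<Longrightarrow> prime p" and e: "e > 0"
  shows "real (card {m. 0 < m \<and> m \<le> X \<and> prime_factors m \<subseteq> P}) \<le>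
    real X powr e * (\<Prod>p\<in>P. 1 / (1 - real p powr - e))"
  using assms(1,2)
proof (induction P arbitrary: X rule: finite_induct)
  case empty
  have "{m. 0 < m \<and> m \<le> X \<and> prime_factors m \<subseteq> {}} \<subseteq> (if X = 0 then {} else {1})"
    by (auto simp: prime_factorization_empty_iff)
  then have "card {m. 0 < m \<and> m \<le> X \<and> prime_factors m \<subseteq> {}} \<le> (if X = 0 then 0 else 1)"
    by (cases "X = 0") (auto dest: card_mono[rotated])
  moreover have "real X powr e \<ge> (if X = 0 then 0 else 1)"
    using e by (auto intro: ge_one_powr_ge_zero)
  ultimately show ?case by (auto split: if_splits)
next
  case (insert p P)
  have p: "prime p" using insert by simp
  define C where "C = (\<Prod>p\<in>P. 1 / (1 - real p powr - e))"
  have pe: "real p powr - e < 1" 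
    using e prime_gt_1_nat[OF p] by (simp add: powr_less_one)
  have C0: "C \<ge> 0" unfolding C_def
  proof (rule prod_nonneg)
    fix q assume "q \<in> P"
    then have "real q powr - e < 1" 
      using e prime_gt_1_nat[of q] insert.prems by (simp add: powr_less_one)
    then show "0 \<le> 1 / (1 - real q powr - e)" by simp
  qed
  have "real (card {m. 0 < m \<and> m \<le> X \<and> prime_factors m \<subseteq> insert p P}) \<le>
    real X powr e * (1 / (1 - real p powr - e) * C)"
  proof (induction X rule: less_induct)
    case (less X)
    show ?case
    proof (cases "X = 0")
      case True
      have "{m. 0 < m \<and> m \<le> X \<and> prime_factors m \<subseteq> insert p P} = {}" using True by auto
      then show ?thesis using True by simp
    next
      case False
      define r where "r = real p powr - e"
      have r: "r < 1" using pe r_def by simp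
      have "X div p < X" using False prime_gt_1_nat[OF p] by simp
      note IH = less[OF this]
      have "real (X div p) powr e \<le> (real X / real p) powr e"
        using e by (intro powr_mono2) (auto simp: of_nat_div_le_of_nat)
      also have "\<dots> = real X powr e * r" by (simp add: powr_divide powr_minus r_def field_simps)
      finally have "real (X div p) powr e * (1 / (1 - r) * C) \<le> real X powr e * r * (1 / (1 - r) * C)"
        using r C0 by (intro mult_right_mono) auto
      then have "real (card {m. 0 < m \<and> m \<le> X \<and> prime_factors m \<subseteq> insert p P}) \<le>
          real X powr e * C + real X powr e * r * (1 / (1 - r) * C)"
        using card_smooth_step[OF p, of X P] IH insert.IH[of X] insert.prems
        unfolding C_def[symmetric] r_def[symmetric] by simp
      \<comment> \<open>The geometric factor closes the recursion:
        \<open>1 + r / (1 - r) = 1 / (1 - r)\<close>.\<close>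
      also have "\<dots> = real X powr e * (1 / (1 - r) * C)" using r by (simp add: field_simps)
      finally show ?thesis by (simp add: r_def)
    qed
  qed
  then show ?case using insert.hyps by (simp add: C_def)
qed

text \<open>An Euler factor is at most \<open>p powr e\<close> once \<open>p powr e \<ge> 2\<close>.
  The exceptional primes lie in the finite set \<open>T\<close>, which depends on \<open>e\<close>
  alone, and each costs at most the factor \<open>c\<close> belonging to the prime 2. The remaining
  product is at most \<open>D powr e\<close>, since the product of the primes dividing
  \<open>D\<close> is at most \<open>D\<close>.\<close>

lemma card_smooth_le:
  fixes e :: real
  assumes e: "e > 0"
  obtains C where "C > 0" "\<And>D X :: nat. D > 0 \<Longrightarrow>
    real (card {m. 0 < m \<and> m \<le> X \<and> prime_factors m \<subseteq> prime_factors D}) \<le>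
      C * real X powr e * real D powr e"
proof
  define c where "c = 1 / (1 - 2 powr - e)"
  define T where "T = {p :: nat. real p powr e < 2}"
  have "(2::real) powr - e < 1" using e by (simp add: powr_less_one)
  then have c: "c \<ge> 1" by (simp add: c_def)
  have "T \<subseteq> {..nat \<lceil>2 powr (1 / e)\<rceil>}"
  proof
    fix p assume "p \<in> T"
    then have "(real p powr e) powr (1 / e) \<le> 2 powr (1 / e)"
      unfolding T_def using e by (intro powr_mono2) auto
    then have "real p \<le> 2 powr (1 / e)" using e by (simp add: powr_powr)
    then show "p \<in> {..nat \<lceil>2 powr (1 / e)\<rceil>}" by (simp add: le_nat_iff) linarith
  qed
  then have T: "finite T" by (rule finite_subset) simp
  show "c ^ card T > 0" using c by simp
  fix D X :: nat assume D: "D > 0"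
  let ?P = "prime_factors D"
  have "(\<Prod>p\<in>?P. 1 / (1 - real p powr - e)) \<le> (\<Prod>p\<in>?P. (if p \<in> T then c else 1) * real p powr e)"
  proof (rule prod_mono, intro conjI)
    fix p assume p: "p \<in> ?P"
    then have p2: "p \<ge> 2" by (simp add: prime_ge_2_nat in_prime_factors_iff)
    have lt: "real p powr - e < 1" using e p2 by (simp add: powr_less_one)
    then show "0 \<le> 1 / (1 - real p powr - e)" by simp
    have ge1: "real p powr e \<ge> 1" using e p2 by (intro ge_one_powr_ge_zero) auto
    show "1 / (1 - real p powr - e) \<le> (if p \<in> T then c else 1) * real p powr e"
    proof (cases "p \<in> T")
      case True
      have "real p powr - e \<le> 2 powr - e" using e p2 by (simp add: powr_mono2')
      then have "1 / (1 - real p powr - e) \<le> c * 1"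
        unfolding c_def using \<open>2 powr - e < 1\<close> by (simp add: frac_le)
      also have "\<dots> \<le> c * real p powr e" using c ge1 by (intro mult_left_mono) auto
      finally show ?thesis using True by simp
    next
      case False
      then have g2: "real p powr e \<ge> 2" by (simp add: T_def)
      define t where "t = real p powr e"
      have "real p powr - e = 1 / t" by (simp add: powr_minus_divide t_def)
      moreover have "1 / (1 - 1 / t) \<le> t" using g2
        by (simp add: t_def[symmetric] field_simps)
      ultimately show ?thesis using False by (simp add: t_def)
    qed
  qed
  also have "\<dots> = (\<Prod>p\<in>?P. if p \<in> T then c else 1) * (\<Prod>p\<in>?P. real p) powr e"
    by (simp add: prod.distrib prod_powr_distrib)
  also have "\<dots> \<le> c ^ card T * real D powr e"
  proof (intro mult_mono)
    have "(\<Prod>p\<in>?P. if p \<in> T then c else 1) = c ^ card (?P \<inter> T)"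
      by (simp add: prod.If_cases Int_def)
    also have "\<dots> \<le> c ^ card T" using c T by (intro power_increasing card_mono) auto
    finally show "(\<Prod>p\<in>?P. if p \<in> T then c else 1) \<le> c ^ card T" .
    have "(\<Prod>p\<in>?P. p) \<le> (\<Prod>p\<in>?P. p ^ multiplicity p D)"
    proof (rule prod_mono, intro conjI)
      fix p assume "p \<in> ?P"
      then have "p \<ge> 2" "multiplicity p D \<ge> 1"
        by (auto simp: prime_ge_2_nat in_prime_factors_iff prime_factors_multiplicity)
      then show "p \<le> p ^ multiplicity p D" using power_increasing[of 1 _ p] by simp
    qed simp
    also have "\<dots> = D" using prime_factorization_nat[of D] D by simp
    finally have "(\<Prod>p\<in>?P. p) \<le> D" .
    then have "(\<Prod>p\<in>?P. real p) \<le> real D" unfolding of_nat_prod[symmetric] of_nat_le_iff .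
    then show "(\<Prod>p\<in>?P. real p) powr e \<le> real D powr e"
      using e by (intro powr_mono2 prod_nonneg) auto
  qed (use c in auto)
  finally have "real X powr e * (\<Prod>p\<in>?P. 1 / (1 - real p powr - e)) \<le>
      real X powr e * (c ^ card T * real D powr e)" by (intro mult_left_mono) auto
  then show "real (card {m. 0 < m \<and> m \<le> X \<and> prime_factors m \<subseteq> prime_factors D}) \<le>
      c ^ card T * real X powr e * real D powr e"
    using card_smooth_le_prod[of ?P e X] e by (simp add: mult_ac in_prime_factors_iff)
qed

section \<open>Matrices of given determinant\<close>

lemma bezout_family:
  fixes f :: "nat \<Rightarrow> int"
  shows "\<exists>u. \<forall>j<n. (\<Sum>i<n. f i * u i) dvd f j"
proof (induction n)
  case (Suc n)
  then obtain u where u: "\<And>j. j < n \<Longrightarrow> (\<Sum>i<n. f i * u i) dvd f j" by blast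
  define s where "s = (\<Sum>i<n. f i * u i)"
  obtain a b where ab: "a * s + b * f n = gcd s (f n)" using bezout_int by blast
  define v where "v = (\<lambda>i. if i < n then a * u i else b)"
  have "(\<Sum>i<Suc n. f i * v i) = gcd s (f n)"
    unfolding ab[symmetric] by (simp add: v_def s_def sum_distrib_left algebra_simps)
  moreover have "gcd s (f n) dvd f j" if "j < Suc n" for j
    using that u[of j] by (cases "j = n") (auto simp: s_def intro: dvd_trans[OF gcd_dvd1])
  ultimately show ?case by (intro exI[of _ v]) simp
qed simp

text \<open>Primitivity is expressed by a Bezout vector \<open>u\<close> instead of a gcd condition,
  because \<open>card_slab\<close> needs vectors on every level of \<open>c'\<close>. The scalar
  \<open>g\<close> is a combination of the entries that divides all of them.\<close>

lemma primitive_vec: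
  fixes c :: "int vec"
  assumes c: "c \<in> carrier_vec n" and nz: "j < n" "c $ j \<noteq> 0"
  obtains g c' u where "g \<noteq> 0" "c' \<in> carrier_vec n" "u \<in> carrier_vec n" "c = g \<cdot>\<^sub>v c'" "c' \<bullet> u = 1"
proof -
  obtain u where u: "\<And>j. j < n \<Longrightarrow> (\<Sum>i<n. c $ i * u i) dvd c $ j"
    using bezout_family[of n "\<lambda>i. c $ i"] by blast
  define g where "g = (\<Sum>i<n. c $ i * u i)"
  define c' where "c' = vec n (\<lambda>i. c $ i div g)"
  have g: "g \<noteq> 0" using u[OF nz(1)] nz(2) by (auto simp: g_def)
  have eq: "c = g \<cdot>\<^sub>v c'" using c u by (intro eq_vecI) (auto simp: c'_def g_def)
  have "g * (c' \<bullet> vec n u) = g"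
    using u by (simp add: scalar_prod_def c'_def sum_distrib_left lessThan_atLeast0 g_def mult.assoc[symmetric])
  then have "c' \<bullet> vec n u = 1" using g by simp
  then show ?thesis using that[OF g _ _ eq, of "vec n u"] by (simp add: c'_def)
qed

section \<open>Determinants of bounded size and the normal vector of the columns\<close>

lemma abs_det_le:
  fixes A :: "int mat"
  assumes A: "A \<in> carrier_mat n n" and bd: "\<And>i j. i < n \<Longrightarrow> j < n \<Longrightarrow> \<bar>A $$ (i, j)\<bar> \<le> h"
  shows "\<bar>det A\<bar> \<le> fact n * h ^ n"
proof -
  let ?U = "{0..<n}"
  have "\<bar>det A\<bar> \<le> (\<Sum>p | p permutes ?U. \<bar>signof p * (\<Prod>i = 0..<n. A $$ (i, p i))\<bar>)"
    unfolding det_def'[OF A] by (rule sum_abs)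
  also have "\<dots> \<le> (\<Sum>p | p permutes ?U. h ^ n)"
  proof (rule sum_mono)
    fix p assume "p \<in> {p. p permutes ?U}"
    then have p: "p i < n" if "i < n" for i using permutes_in_image[of p ?U i] that by simp
    have "\<bar>\<Prod>i = 0..<n. A $$ (i, p i)\<bar> \<le> (\<Prod>i = 0..<n. h)"
      unfolding abs_prod by (intro prod_mono) (auto simp: bd p)
    then show "\<bar>signof p * (\<Prod>i = 0..<n. A $$ (i, p i))\<bar> \<le> h ^ n"
      by (simp add: abs_mult sign_def)
  qed
  also have "\<dots> = fact n * h ^ n" by (simp add: card_permutations)
  finally show ?thesis .
qed

lemma abs_cofactor_le:
  fixes A :: "int mat"
  assumes A: "A \<in> carrier_mat n n" and bd: "\<And>i j. i < n \<Longrightarrow> j < n \<Longrightarrow> \<bar>A $$ (i, j)\<bar> \<le> h"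
    and h: "h \<ge> 1" and ij: "i < n" "j < n"
  shows "\<bar>cofactor A i j\<bar> \<le> fact n * h ^ n"
proof -
  have M: "mat_delete A i j \<in> carrier_mat (n - 1) (n - 1)" using A by (simp add: mat_delete_def)
  have "\<bar>cofactor A i j\<bar> = \<bar>det (mat_delete A i j)\<bar>"
    by (simp add: cofactor_def abs_mult power_abs)
  also have "\<dots> \<le> fact (n - 1) * h ^ (n - 1)"
    using A ij by (intro abs_det_le[OF M]) (auto simp: mat_delete_def intro!: bd)
  also have "\<dots> \<le> fact n * h ^ n"
    using h by (intro mult_mono fact_mono power_increasing) auto
  finally show ?thesis .
qed

lemma sum_inverse_le_ln:
  assumes "X \<ge> 1"
  shows "(\<Sum>t\<in>{- int X..int X}. 1 / max 1 \<bar>real_of_int t\<bar>) \<le> 3 + 2 * ln (real X)"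
  using assms
proof (induction X rule: nat_induct_at_least)
  case base
  have "{- int 1..int 1} = {-1, 0, 1}" by auto
  then show ?case by simp
next
  case (Suc X)
  have "{- int (Suc X)..int (Suc X)} = insert (- int (Suc X)) (insert (int (Suc X)) {- int X..int X})"
    by auto
  then have "(\<Sum>t\<in>{- int (Suc X)..int (Suc X)}. 1 / max 1 \<bar>real_of_int t\<bar>) =
      2 / (real X + 1) + (\<Sum>t\<in>{- int X..int X}. 1 / max 1 \<bar>real_of_int t\<bar>)"
    by (simp add: max_def field_simps)
  moreover have "1 / (real X + 1) \<le> ln (real (Suc X)) - ln (real X)"
  proof -
    have "ln (real X / (real X + 1)) \<le> real X / (real X + 1) - 1"
      using Suc.hyps by (intro ln_le_minus_one) auto
    also have "\<dots> = - (1 / (real X + 1))" by (simp add: field_simps)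
    finally show ?thesis using Suc.hyps by (simp add: ln_div algebra_simps)
  qed
  ultimately show ?case using Suc.IH by simp
qed

lemma cofactor_scalar_prod_col:
  fixes A :: "'a :: comm_ring_1 mat"
  assumes A: "A \<in> carrier_mat n n" and k: "k < n"
  shows "vec n (\<lambda>i. cofactor A i 0) \<bullet> col A k = (if k = 0 then det A else 0)"
proof -
  have n: "0 < n" using k by simp
  have "row (adj_mat A) 0 = vec n (\<lambda>i. cofactor A i 0)"
    using A n by (intro eq_vecI) (auto simp: adj_mat_def)
  then have "vec n (\<lambda>i. cofactor A i 0) \<bullet> col A k = (adj_mat A * A) $$ (0, k)"
    using adj_mat(1)[OF A] A n k by simp
  then show ?thesis unfolding adj_mat(3)[OF A] using n k by simp
qed

text \<open>Supplies the non-singular lattice for \<open>card_slab\<close>: its determinant is the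
  coordinate of the normal vector at \<open>m\<close>, which is non-zero for a suitable
  \<open>m\<close>.\<close>

lemma det_unit_col0:
  fixes A :: "'a :: comm_ring_1 mat"
  assumes A: "A \<in> carrier_mat n n" and m: "m < n"
  defines "N \<equiv> mat n n (\<lambda>(i, j). if j = 0 then (if i = m then 1 else 0) else A $$ (i, j))"
  shows "det N = cofactor A m 0"
proof -
  have N: "N \<in> carrier_mat n n" by (simp add: N_def)
  have "mat_delete N m 0 = mat_delete A m 0"
    using A m by (intro eq_matI) (auto simp: mat_delete_def N_def)
  then have cof: "cofactor N m 0 = cofactor A m 0" by (simp add: cofactor_def)
  have "det N = (\<Sum>i<n. N $$ (i, 0) * cofactor N i 0)"
    using m by (intro laplace_expansion_column[OF N]) simp
  also have "\<dots> = (\<Sum>i<n. if i = m then cofactor N m 0 else 0)"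
    using m by (intro sum.cong) (auto simp: N_def)
  finally show ?thesis using m cof by simp
qed

text \<open>
  With \<open>c\<close> the primitive vector on the line of the cofactors of column 0, the remaining columns
  lie in the hyperplane \<open>c \<bullet> x = 0\<close> and column 0 lies on a level set of \<open>c\<close> at a divisor of \<open>d\<close>.
\<close>

lemma exists_primitive_normal:
  fixes A :: "int mat"
  assumes A: "A \<in> bounded_int_mats n (real h)" and d: "det A = d" "d \<noteq> 0"
    and h: "h \<ge> 1" and n: "n \<ge> 1"
  obtains c e m where "c \<in> int_box n (fact n * h ^ n)" "e dvd d" "m < n" "c $ m \<noteq> 0"
    "\<And>i. i < n \<Longrightarrow> \<bar>c $ i\<bar> \<le> \<bar>c $ m\<bar>"
    "\<And>j. j < n \<Longrightarrow> c \<bullet> col A j = (if j = 0 then e else 0)"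
    "\<And>e'. card {x \<in> int_box n h. c \<bullet> x = e'} * (nat \<bar>c $ m\<bar> * h) \<le> ((2 * n + 5) * h) ^ n"
proof -
  have Ac: "A \<in> carrier_mat n n" and "\<And>i j. i < n \<Longrightarrow> j < n \<Longrightarrow> \<bar>real_of_int (A $$ (i, j))\<bar> \<le> real h"
    using A by (auto simp: bounded_int_mats_def)
  then have bd: "\<bar>A $$ (i, j)\<bar> \<le> int h" if "i < n" "j < n" for i j
    using that by (metis of_int_abs of_int_le_iff of_int_of_nat_eq)
  define b where "b = vec n (\<lambda>i. cofactor A i 0)"
  have b: "b \<in> carrier_vec n" by (simp add: b_def)
  have bcol: "b \<bullet> col A k = (if k = 0 then d else 0)" if "k < n" for k
    unfolding b_def d(1)[symmetric] by (rule cofactor_scalar_prod_col[OF Ac that])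
  have "\<exists>k<n. b $ k \<noteq> 0"
  proof (rule ccontr)
    assume "\<not> ?thesis"
    then have "b \<bullet> col A 0 = 0" using Ac b n by (auto simp: scalar_prod_def)
    then show False using bcol[of 0] n d by simp
  qed
  then obtain k where "k < n" "b $ k \<noteq> 0" by blast
  then obtain g c u where g: "g \<noteq> 0" and c: "c \<in> carrier_vec n" and u: "u \<in> carrier_vec n" "c \<bullet> u = 1"
    and bg: "b = g \<cdot>\<^sub>v c"
    using primitive_vec[OF b] by metis
  have gcol: "g * (c \<bullet> col A k) = (if k = 0 then d else 0)" if "k < n" for k
    using bcol[OF that] Ac c that unfolding bg by simp
  \<comment> \<open>A coordinate of largest absolute value, so that \<open>\<bar>c $ m\<bar>\<close>
    is the maximum norm of \<open>c\<close>.\<close>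
  obtain m where m: "m < n" "\<And>i. i < n \<Longrightarrow> \<bar>c $ i\<bar> \<le> \<bar>c $ m\<bar>"
  proof -
    have "finite ((\<lambda>i. \<bar>c $ i\<bar>) ` {..<n})" "(\<lambda>i. \<bar>c $ i\<bar>) ` {..<n} \<noteq> {}"
      using n by (auto simp: lessThan_empty_iff)
    from Max_in[OF this] Max_ge[OF this(1)] show ?thesis using that by fastforce
  qed
  have cm: "c $ m \<noteq> 0"
  proof
    assume "c $ m = 0"
    then have "c \<bullet> u = 0" using m(2) u by (auto simp: scalar_prod_def)
    then show False using u by simp
  qed
  \<comment> \<open>Columns of \<open>A\<close> other than the first lie on the level 0 of
    \<open>c\<close>, and the unit vector that replaces column 0 lies on the level
    \<open>c $ m\<close>. All values of \<open>c\<close> on this lattice are therefore multiples of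
    \<open>c $ m\<close>.\<close>
  define N where "N = mat n n (\<lambda>(i, j). if j = 0 then (if i = m then 1 else 0) else A $$ (i, j))"
  have N: "N \<in> carrier_mat n n" by (simp add: N_def)
  have "det N = b $ m" unfolding N_def using det_unit_col0[OF Ac m(1)] m by (simp add: b_def)
  then have dN: "det N \<noteq> 0" using cm g m c by (simp add: bg)
  have bdN: "\<bar>N $$ (i, j)\<bar> \<le> int h" if "i < n" "j < n" for i j
    using bd[OF that] that h by (auto simp: N_def)
  have dvd: "c $ m dvd col N j \<bullet> c" if j: "j < n" for j
  proof (cases "j = 0")
    case True
    have "col N 0 = unit_vec n m" using n by (intro eq_vecI) (auto simp: N_def unit_vec_def)
    then show ?thesis using True c m by simp
  next
    case False
    have "col N j = col A j" using j False Ac by (intro eq_vecI) (auto simp: N_def)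
    then have "col N j \<bullet> c = c \<bullet> col A j" using Ac c j by (simp add: comm_scalar_prod[of _ n])
    also have "\<dots> = 0" using gcol[OF j] g False by simp
    finally show ?thesis by simp
  qed
  show ?thesis
  proof (rule that[of c "c \<bullet> col A 0" m])
    show "c \<in> int_box n (fact n * h ^ n)" unfolding int_box_def
    proof (intro CollectI conjI allI impI c)
      fix i assume i: "i < n"
      have "\<bar>c $ i\<bar> \<le> \<bar>g\<bar> * \<bar>c $ i\<bar>" using g mult_right_mono[of 1 "\<bar>g\<bar>" "\<bar>c $ i\<bar>"] by simp
      also have "\<dots> = \<bar>b $ i\<bar>" using i c by (simp add: bg abs_mult)
      also have "\<dots> \<le> fact n * int h ^ n"
        using abs_cofactor_le[OF Ac bd, of i 0] i n h by (simp add: b_def)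
      finally show "\<bar>c $ i\<bar> \<le> int (fact n * h ^ n)" by simp
    qed
    show "c \<bullet> col A 0 dvd d" using gcol[of 0] n by (metis dvd_triv_right less_eq_Suc_le One_nat_def)
    show "c \<bullet> col A j = (if j = 0 then c \<bullet> col A 0 else 0)" if "j < n" for j
      using gcol[OF that] g by auto
    show "card {x \<in> int_box n h. c \<bullet> x = e'} * (nat \<bar>c $ m\<bar> * h) \<le> ((2 * n + 5) * h) ^ n" for e'
      by (rule card_slab[OF N dN bdN h c u m(1) cm dvd])
  qed (use m cm in auto)
qed

text \<open>For fixed \<open>c\<close> and \<open>e\<close> each of the \<open>n\<close> columns
  lies in one slab, which leaves \<open>(K / \<parallel>c\<parallel>) ^ n\<close> matrices, with
  \<open>K\<close> of order \<open>h ^ (n - 1)\<close>. The divisors \<open>e\<close> of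
  \<open>d\<close> give the first factor, and summing over \<open>c\<close> gives the last.\<close>

lemma card_det_eq_le:
  fixes d :: int
  assumes d: "d \<noteq> 0" and h: "h \<ge> 1" and n: "n \<ge> 1"
  shows "real (card {A \<in> bounded_int_mats n (real h). det A = d}) \<le>
    real (card {e. e dvd d}) * (real ((2 * n + 5) ^ n) * real h ^ (n - 1)) ^ n *
      (3 + 2 * ln (fact n * real h ^ n)) ^ n"
proof -
  define X :: nat where "X = fact n * h ^ n"
  define K where "K = real ((2 * n + 5) ^ n) * real h ^ (n - 1)"
  define L where "L = (\<lambda>c e. {x \<in> int_box n h. c \<bullet> x = e})"
  \<comment> \<open>The slab estimate is known only for a \<open>c\<close> that arises from some
    matrix, since the lattice in its proof is made of columns of that matrix. It is recorded as a
    property of \<open>c\<close>, and the union below runs over such \<open>c\<close> only.\<close>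
  define good where "good = (\<lambda>c m. m < n \<and> c $ m \<noteq> 0 \<and> (\<forall>i<n. \<bar>c $ i\<bar> \<le> \<bar>c $ m\<bar>) \<and>
    (\<forall>e. card (L c e) * (nat \<bar>c $ m\<bar> * h) \<le> ((2 * n + 5) * h) ^ n))"
  define G where "G = {c \<in> int_box n X. \<exists>m. good c m}"
  define T where "T = (\<lambda>c e. {A :: int mat. A \<in> carrier_mat n n \<and>
    (\<forall>j<n. col A j \<in> (if j = 0 then L c e else L c 0))})"
  \<comment> \<open>This product replaces the \<open>n\<close>-th power of the inverse norm, which
    it dominates because no coordinate exceeds the norm. It factors over coordinates, so its sum
    over a box is a power of a harmonic sum.\<close>
  define w where "w = (\<lambda>c :: int vec. \<Prod>i<n. 1 / max 1 \<bar>real_of_int (c $ i)\<bar>)"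
  have finL: "finite (L c e)" for c e by (simp add: L_def finite_int_box)
  have finT: "finite (T c e)" for c e
    unfolding T_def using finL by (intro finite_card_mat_cols(1)) auto
  have finG: "finite G" by (simp add: G_def finite_int_box)
  have finD: "finite {e. e dvd d}" using d by simp
  have sub: "{A \<in> bounded_int_mats n (real h). det A = d} \<subseteq> (\<Union>(c, e)\<in>G \<times> {e. e dvd d}. T c e)"
  proof
    fix A assume "A \<in> {A \<in> bounded_int_mats n (real h). det A = d}"
    then have A: "A \<in> bounded_int_mats n (real h)" and dA: "det A = d" by auto
    have "\<exists>c e m. c \<in> int_box n X \<and> e dvd d \<and> good c m \<and>
      (\<forall>j<n. c \<bullet> col A j = (if j = 0 then e else 0))"
    proof (rule exists_primitive_normal[OF A dA d h n])
      fix c e m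
      assume *: "c \<in> int_box n (fact n * h ^ n)" "e dvd d" "m < n" "c $ m \<noteq> 0"
        "\<And>i. i < n \<Longrightarrow> \<bar>c $ i\<bar> \<le> \<bar>c $ m\<bar>"
        "\<And>j. j < n \<Longrightarrow> c \<bullet> col A j = (if j = 0 then e else 0)"
        "\<And>e'. card {x \<in> int_box n h. c \<bullet> x = e'} * (nat \<bar>c $ m\<bar> * h) \<le> ((2 * n + 5) * h) ^ n"
      then have "good c m" unfolding good_def L_def by (intro conjI allI impI)
      then show ?thesis using * unfolding X_def by (intro exI[of _ c] exI[of _ e] exI[of _ m]) simp
    qed
    then obtain c e m where c: "c \<in> int_box n X" "e dvd d" and gm: "good c m"
      and col: "\<And>j. j < n \<Longrightarrow> c \<bullet> col A j = (if j = 0 then e else 0)" by blast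
    have "col A j \<in> int_box n h" if "j < n" for j
      using A that by (auto simp: bounded_int_mats_def int_box_def)
        (metis of_int_abs of_int_le_iff of_int_of_nat_eq)
    then have "A \<in> T c e" using A col by (auto simp: T_def L_def bounded_int_mats_def)
    then show "A \<in> (\<Union>(c, e)\<in>G \<times> {e. e dvd d}. T c e)" using c gm by (auto simp: G_def X_def)
  qed
  have cardT: "real (card (T c e)) \<le> K ^ n * w c" if cG: "c \<in> G" for c e
  proof -
    obtain m where "good c m" using cG by (auto simp: G_def)
    then have m: "m < n" "c $ m \<noteq> 0" "\<And>i. i < n \<Longrightarrow> \<bar>c $ i\<bar> \<le> \<bar>c $ m\<bar>"
      and cL: "\<And>e. card (L c e) * (nat \<bar>c $ m\<bar> * h) \<le> ((2 * n + 5) * h) ^ n"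
      by (auto simp: good_def)
    define q where "q = real_of_int \<bar>c $ m\<bar>"
    have q: "q \<ge> 1" using m(2) unfolding q_def by linarith
    have cL': "real (card (L c e)) \<le> K / q" for e
    proof -
      have "real (card (L c e) * (nat \<bar>c $ m\<bar> * h)) \<le> real (((2 * n + 5) * h) ^ n)"
        using cL[of e] of_nat_le_iff by blast
      then have "real (card (L c e)) * q * real h \<le> real ((2 * n + 5) ^ n) * real h ^ n"
        by (simp add: q_def power_mult_distrib mult.assoc)
      also have "real h ^ n = real h ^ (n - 1) * real h" using n by (simp add: power_eq_if mult.commute)
      finally have "real (card (L c e)) * q \<le> K" using h by (simp add: K_def)
      then show ?thesis using q by (simp add: field_simps)
    qed
    have "real (card (T c e)) \<le> real (\<Prod>j<n. card (if j = 0 then L c e else L c 0))"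
      unfolding T_def of_nat_le_iff using finL by (intro finite_card_mat_cols(2)) auto
    also have "\<dots> \<le> (\<Prod>j<n. K / q)" unfolding of_nat_prod using cL' by (intro prod_mono) auto
    also have "\<dots> = K ^ n * (\<Prod>j<n. 1 / q)" by (simp add: power_divide)
    also have "\<dots> \<le> K ^ n * w c"
    proof (intro mult_left_mono)
      show "(\<Prod>j<n. 1 / q) \<le> w c" unfolding w_def
      proof (intro prod_mono conjI)
        fix i assume "i \<in> {..<n}"
        then have "\<bar>real_of_int (c $ i)\<bar> \<le> q" unfolding q_def using m(3)[of i] by (metis lessThan_iff of_int_abs of_int_le_iff)
        then show "1 / q \<le> 1 / max 1 \<bar>real_of_int (c $ i)\<bar>" using q by (intro frac_le) auto
      qed (use q in auto)
    qed (auto simp: K_def)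
    finally show ?thesis .
  qed
  have "real (card {A \<in> bounded_int_mats n (real h). det A = d}) \<le>
      real (card (\<Union>(c, e)\<in>G \<times> {e. e dvd d}. T c e))"
    unfolding of_nat_le_iff using finG finD finT by (intro card_mono[OF _ sub]) auto
  also have "\<dots> \<le> real (\<Sum>(c, e)\<in>G \<times> {e. e dvd d}. card (T c e))"
    unfolding of_nat_le_iff using finG finD by (intro order.trans[OF card_UN_le]) (auto simp: case_prod_beta)
  also have "\<dots> = (\<Sum>(c, e)\<in>G \<times> {e. e dvd d}. real (card (T c e)))" by (simp add: case_prod_beta)
  also have "\<dots> \<le> (\<Sum>(c, e)\<in>G \<times> {e. e dvd d}. K ^ n * w c)" 
    using cardT by (intro sum_mono) auto
  also have "\<dots> = real (card {e. e dvd d}) * K ^ n * (\<Sum>c\<in>G. w c)"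
    using finG finD by (simp add: sum.cartesian_product[symmetric] sum_distrib_right mult_ac)
  also have "(\<Sum>c\<in>G. w c) \<le> (\<Sum>c\<in>int_box n X. w c)"
    by (intro sum_mono2 finite_int_box) (auto simp: G_def w_def intro!: prod_nonneg)
  also have "\<dots> = (\<Sum>t\<in>{- int X..int X}. 1 / max 1 \<bar>real_of_int t\<bar>) ^ n"
    unfolding w_def by (rule sum_int_box_prod)
  also have "\<dots> \<le> (3 + 2 * ln (real X)) ^ n"
  proof (intro power_mono sum_inverse_le_ln sum_nonneg)
    have "X > 0" using h by (simp add: X_def)
    then show "X \<ge> 1" by simp
  qed auto
  finally show ?thesis by (simp add: K_def X_def mult_left_mono)
qed

text \<open>The divisor bound is the case \<open>X = D\<close> of the count of integers composed of
  the primes of \<open>D\<close>: positive divisors of \<open>D\<close> are such integers, and the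
  sign doubles their number.\<close>

lemma card_int_divisors_le:
  fixes e :: real
  assumes e: "e > 0"
  obtains C where "C > 0" "\<And>d :: int. d \<noteq> 0 \<Longrightarrow> real (card {k. k dvd d}) \<le> C * \<bar>real_of_int d\<bar> powr e"
proof -
  obtain C where C: "C > 0" "\<And>D X :: nat. D > 0 \<Longrightarrow>
    real (card {m. 0 < m \<and> m \<le> X \<and> prime_factors m \<subseteq> prime_factors D}) \<le>
      C * real X powr (e / 2) * real D powr (e / 2)"
    using card_smooth_le[of "e / 2"] e by auto
  have "real (card {k. k dvd d}) \<le> (2 * C) * \<bar>real_of_int d\<bar> powr e" if d: "d \<noteq> 0" for d
  proof -
    define D where "D = nat \<bar>d\<bar>"
    define S where "S = {m. 0 < m \<and> m \<le> D \<and> prime_factors m \<subseteq> prime_factors D}"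
    have D: "D > 0" using d by (simp add: D_def)
    have fS: "finite S" unfolding S_def by (rule finite_subset[of _ "{..D}"]) auto
    have "{k. k dvd d} \<subseteq> int ` S \<union> (\<lambda>m. - int m) ` S"
    proof
      fix k assume "k \<in> {k. k dvd d}"
      then have k: "k dvd d" by simp
      then have kD: "nat \<bar>k\<bar> dvd D" by (simp add: D_def nat_abs_dvd_iff)
      then have "prime_factors (nat \<bar>k\<bar>) \<subseteq> prime_factors D" using D by (intro dvd_prime_factors) auto
      moreover have "k \<noteq> 0" using k d by auto
      ultimately have "nat \<bar>k\<bar> \<in> S" using dvd_imp_le[OF kD] D by (auto simp: S_def)
      moreover have "k = int (nat \<bar>k\<bar>) \<or> k = - int (nat \<bar>k\<bar>)" by linarith
      ultimately show "k \<in> int ` S \<union> (\<lambda>m. - int m) ` S" by blast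
    qed
    then have "card {k. k dvd d} \<le> card (int ` S \<union> (\<lambda>m. - int m) ` S)"
      using fS by (intro card_mono) auto
    also have "\<dots> \<le> card S + card S"
      by (rule order.trans[OF card_Un_le add_mono[OF card_image_le[OF fS] card_image_le[OF fS]]])
    finally have "real (card {k. k dvd d}) \<le> 2 * real (card S)" by simp
    also have "\<dots> \<le> 2 * (C * real D powr (e / 2) * real D powr (e / 2))"
      using C(2)[OF D, of D] by (simp add: S_def)
    also have "\<dots> = 2 * C * real D powr e" by (simp add: powr_add[symmetric])
    finally show ?thesis by (simp add: D_def)
  qed
  then show ?thesis using that[of "2 * C"] C(1) by simp
qed

section \<open>Counts of matrices by determinant, with all losses in a small power\<close>

lemma bounded_int_mats_abs_le:
  assumes "A \<in> bounded_int_mats n (real h)" "i < n" "j < n"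
  shows "\<bar>A $$ (i, j)\<bar> \<le> int h"
proof -
  have "\<bar>real_of_int (A $$ (i, j))\<bar> \<le> real h" using assms by (auto simp: bounded_int_mats_def)
  then show ?thesis by linarith
qed

lemma abs_det_bounded_int_mats:
  assumes "A \<in> bounded_int_mats n (real h)"
  shows "nat \<bar>det A\<bar> \<le> fact n * h ^ n"
proof -
  have "\<bar>det A\<bar> \<le> fact n * int h ^ n"
    using assms bounded_int_mats_abs_le[OF assms] by (intro abs_det_le) (auto simp: bounded_int_mats_def)
  also have "\<dots> = int (fact n * h ^ n)" by simp
  finally show ?thesis by linarith
qed

lemma bounded_int_mats_cols: 
  "bounded_int_mats n (real h) = {A \<in> carrier_mat n n. \<forall>j<n. col A j \<in> int_box n h}" (is "?L = ?R")
proof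
  show "?L \<subseteq> ?R"
    using bounded_int_mats_abs_le by (fastforce simp: bounded_int_mats_def int_box_def)
  show "?R \<subseteq> ?L"
  proof
    fix A assume A: "A \<in> ?R"
    have "\<bar>A $$ (i, j)\<bar> \<le> int h" if "i < n" "j < n" for i j
      using A that by (auto simp: int_box_def)
    then have "\<bar>real_of_int (A $$ (i, j))\<bar> \<le> real h" if "i < n" "j < n" for i j
      using that by (metis of_int_abs of_int_le_iff of_int_of_nat_eq)
    then show "A \<in> ?L" using A by (auto simp: bounded_int_mats_def)
  qed
qed

lemma finite_bounded_int_mats: "finite (bounded_int_mats n (real h))"
  unfolding bounded_int_mats_cols by (rule finite_card_mat_cols(1)) (rule finite_int_box)

lemma card_bounded_int_mats_le: "card (bounded_int_mats n (real h)) \<le> (2 * h + 1) ^ n\<^sup>2"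
proof -
  have "card (bounded_int_mats n (real h)) \<le> (\<Prod>j<n. card (int_box n h))"
    unfolding bounded_int_mats_cols by (rule finite_card_mat_cols(2)) (rule finite_int_box)
  then show ?thesis by (simp add: card_int_box power_mult[symmetric] power2_eq_square)
qed

lemma card_det_eq_powr_le:
  assumes e: "e > 0" and n: "n \<ge> 1"
  obtains C where "C > 0" "\<And>h d. h \<ge> 1 \<Longrightarrow> d \<noteq> 0 \<Longrightarrow>
    real (card {A \<in> bounded_int_mats n (real h). det A = d}) \<le>
      C * real (fact n * h ^ n) powr e * real h ^ (n * (n - 1))"
proof -
  obtain C1 where C1: "C1 > 0"
    "\<And>d :: int. d \<noteq> 0 \<Longrightarrow> real (card {k. k dvd d}) \<le> C1 * \<bar>real_of_int d\<bar> powr (e / 2)"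
    using card_int_divisors_le[of "e / 2"] e by auto
  \<comment> \<open>The logarithm occurs to the power \<open>n\<close>; bounding it by a multiple of
    \<open>X powr a\<close> makes the total loss \<open>X powr (e / 2)\<close>. The divisors of
    \<open>d\<close> take the other half of \<open>e\<close>.\<close>
  define a where "a = e / (2 * real n)"
  have a: "a > 0" using e n by (simp add: a_def)
  define C2 where "C2 = (3 + 2 / a) ^ n"
  define C3 where "C3 = real ((2 * n + 5) ^ n) ^ n"
  have pos: "C2 > 0" "C3 > 0" using a by (auto simp: C2_def C3_def intro!: zero_less_power add_pos_pos)
  show ?thesis
  proof (rule that[of "C1 * C2 * C3"])
    show "C1 * C2 * C3 > 0" using C1 pos by simp
    fix h :: nat and d :: int
    assume h: "h \<ge> 1" and d: "d \<noteq> 0"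
    define X where "X = real (fact n * h ^ n)"
    let ?S = "{A \<in> bounded_int_mats n (real h). det A = d}"
    have X1: "X \<ge> 1"
    proof -
      have "fact n * h ^ n > 0" using h by simp
      then have "real 1 \<le> X" unfolding X_def by (intro of_nat_mono) linarith
      then show ?thesis by simp
    qed
    show "real (card ?S) \<le> C1 * C2 * C3 * real (fact n * h ^ n) powr e * real h ^ (n * (n - 1))"
    \<comment> \<open>The divisor bound is in terms of \<open>d\<close>, which is arbitrary. Only
      the existence of a matrix with determinant \<open>d\<close> forces
      \<open>|d| \<le> X\<close>.\<close>
    proof (cases "?S = {}")
      case True
      show ?thesis unfolding True using C1(1) pos by simp
    next
      case False
      then obtain A where "A \<in> bounded_int_mats n (real h)" "det A = d" by blast
      then have "nat \<bar>d\<bar> \<le> fact n * h ^ n" using abs_det_bounded_int_mats by blast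
      then have dX: "\<bar>real_of_int d\<bar> \<le> X" unfolding X_def by linarith
      have "C1 * \<bar>real_of_int d\<bar> powr (e / 2) \<le> C1 * X powr (e / 2)"
        using C1 dX e by (intro mult_left_mono powr_mono2) auto
      then have div: "real (card {k. k dvd d}) \<le> C1 * X powr (e / 2)" using C1(2)[OF d] by simp
      have "3 + 2 * ln X \<le> 3 * X powr a + 2 * (X powr a / a)"
        using ln_powr_bound[OF X1 a] ge_one_powr_ge_zero[OF X1, of a] a by linarith
      also have "\<dots> = (3 + 2 / a) * X powr a" by (simp add: algebra_simps)
      finally have "(3 + 2 * ln X) ^ n \<le> ((3 + 2 / a) * X powr a) ^ n"
        using X1 by (intro power_mono) auto
      also have "\<dots> = C2 * X powr (e / 2)"
        using X1 n by (simp add: C2_def a_def power_mult_distrib powr_power)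
      finally have log: "(3 + 2 * ln X) ^ n \<le> C2 * X powr (e / 2)" .
      have "real (card ?S) \<le> real (card {k. k dvd d}) *
          (real ((2 * n + 5) ^ n) * real h ^ (n - 1)) ^ n * (3 + 2 * ln X) ^ n"
        using card_det_eq_le[OF d h n] by (simp add: X_def)
      also have "\<dots> \<le> (C1 * X powr (e / 2)) *
          (real ((2 * n + 5) ^ n) * real h ^ (n - 1)) ^ n * (C2 * X powr (e / 2))"
        using div log C1 X1 by (intro mult_mono) auto
      also have "\<dots> = C1 * C2 * C3 * (X powr (e / 2) * X powr (e / 2)) * real h ^ (n * (n - 1))"
        by (simp add: C3_def power_mult_distrib power_mult[symmetric] mult_ac del: of_nat_power of_nat_mult)
      also have "X powr (e / 2) * X powr (e / 2) = X powr e" by (simp add: powr_add[symmetric])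
      finally show ?thesis by (simp add: X_def)
    qed
  qed
qed

text \<open>The admissible determinants number only \<open>H powr o(1)\<close>, so summing over them
  keeps the exponent of a single one. The size condition on \<open>D\<close> is that of a product of
  at most \<open>k\<close> determinants.\<close>

lemma card_det_smooth_le:
  assumes e: "e > 0" and n: "n \<ge> 1"
  obtains C where "C > 0" "\<And>h D. h \<ge> 1 \<Longrightarrow> D > 0 \<Longrightarrow> D \<le> (fact n * h ^ n) ^ k \<Longrightarrow>
    real (card {A \<in> bounded_int_mats n (real h).
        det A \<noteq> 0 \<and> prime_factors (nat \<bar>det A\<bar>) \<subseteq> prime_factors D}) \<le>
      C * real h powr ((real n)\<^sup>2 - real n + e)"
proof -
  \<comment> \<open>Three losses are paid with exponent \<open>a\<close>: \<open>X\<close> for a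
    fixed determinant, \<open>X\<close> for the number of determinants, and \<open>D\<close>, which
    is at most \<open>X ^ k\<close>. As \<open>X\<close> has order \<open>h ^ n\<close>, they add up
    to \<open>n * (k + 2) * a = e\<close>.\<close>
  define a where "a = e / (real n * (real k + 2))"
  have a: "a > 0" using e n by (simp add: a_def)
  have "real n * (a + a + real k * a) = a * (real n * (real k + 2))" by (simp add: algebra_simps)
  also have "\<dots> = e" using n by (simp add: a_def)
  finally have na: "real n * (a + a + real k * a) = e" .
  obtain C1 where C1: "C1 > 0" "\<And>h d. h \<ge> 1 \<Longrightarrow> d \<noteq> 0 \<Longrightarrow>
    real (card {A \<in> bounded_int_mats n (real h). det A = d}) \<le>
      C1 * real (fact n * h ^ n) powr a * real h ^ (n * (n - 1))"
    using card_det_eq_powr_le[OF a n] by auto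
  obtain C2 where C2: "C2 > 0" "\<And>D X :: nat. D > 0 \<Longrightarrow>
    real (card {m. 0 < m \<and> m \<le> X \<and> prime_factors m \<subseteq> prime_factors D}) \<le>
      C2 * real X powr a * real D powr a"
    using card_smooth_le[OF a] by auto
  define F :: real where "F = fact n powr (a + a + real k * a)"
  show ?thesis
  proof (rule that[of "2 * C1 * C2 * F"])
    show "2 * C1 * C2 * F > 0" using C1 C2 by (simp add: F_def)
    fix h D :: nat
    assume h: "h \<ge> 1" and D: "D > 0" "D \<le> (fact n * h ^ n) ^ k"
    define X :: nat where "X = fact n * h ^ n"
    define S where "S = {m. 0 < m \<and> m \<le> X \<and> prime_factors m \<subseteq> prime_factors D}"
    define T where "T = int ` S \<union> (\<lambda>m. - int m) ` S"
    define M where "M = {A \<in> bounded_int_mats n (real h).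
        det A \<noteq> 0 \<and> prime_factors (nat \<bar>det A\<bar>) \<subseteq> prime_factors D}"
    have X0: "X > 0" using h by (simp add: X_def)
    have fS: "finite S" unfolding S_def by (rule finite_subset[of _ "{..X}"]) auto
    then have fT: "finite T" by (simp add: T_def)
    have "M \<subseteq> (\<Union>d\<in>T. {A \<in> bounded_int_mats n (real h). det A = d})"
    proof
      fix A assume A: "A \<in> M"
      then have "nat \<bar>det A\<bar> \<in> S"
        using abs_det_bounded_int_mats[of A n h] by (auto simp: M_def S_def X_def)
      moreover have "det A = int (nat \<bar>det A\<bar>) \<or> det A = - int (nat \<bar>det A\<bar>)" by linarith
      ultimately have "det A \<in> T" unfolding T_def by blast
      then show "A \<in> (\<Union>d\<in>T. {A \<in> bounded_int_mats n (real h). det A = d})"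
        using A by (auto simp: M_def)
    qed
    then have "card M \<le> card (\<Union>d\<in>T. {A \<in> bounded_int_mats n (real h). det A = d})"
      using fT finite_bounded_int_mats by (intro card_mono) auto
    also have "\<dots> \<le> (\<Sum>d\<in>T. card {A \<in> bounded_int_mats n (real h). det A = d})"
      by (rule card_UN_le[OF fT])
    finally have "real (card M) \<le> (\<Sum>d\<in>T. real (card {A \<in> bounded_int_mats n (real h). det A = d}))"
      by (simp only: of_nat_sum[symmetric] of_nat_le_iff)
    also have "\<dots> \<le> (\<Sum>d\<in>T. C1 * real X powr a * real h ^ (n * (n - 1)))"
      unfolding X_def using h by (intro sum_mono C1(2)) (auto simp: T_def S_def)
    also have "\<dots> = real (card T) * (C1 * real X powr a * real h ^ (n * (n - 1)))" by simp
    also have "\<dots> \<le> (2 * (C2 * real X powr a * (real X ^ k) powr a)) *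
        (C1 * real X powr a * real h ^ (n * (n - 1)))"
    proof (intro mult_right_mono)
      have "card T \<le> card S + card S" unfolding T_def
        by (rule order.trans[OF card_Un_le add_mono[OF card_image_le[OF fS] card_image_le[OF fS]]])
      then have "real (card T) \<le> 2 * real (card S)" by simp
      also have "\<dots> \<le> 2 * (C2 * real X powr a * real D powr a)"
        using C2(2)[OF D(1), of X] by (simp add: S_def)
      also have "\<dots> \<le> 2 * (C2 * real X powr a * (real X ^ k) powr a)"
      proof (intro mult_left_mono powr_mono2)
        have "real D \<le> real (X ^ k)" using D(2) unfolding X_def of_nat_le_iff .
        then show "real D \<le> real X ^ k" by simp
      qed (use a C2 in auto)
      finally show "real (card T) \<le> 2 * (C2 * real X powr a * (real X ^ k) powr a)" .
    qed (use C1 in auto)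
    also have "\<dots> = 2 * C1 * C2 * real X powr (a + a + real k * a) * real h ^ (n * (n - 1))"
    proof -
      have "(real X ^ k) powr a = real X powr (real k * a)"
        using X0 by (simp add: powr_realpow[symmetric] powr_powr)
      then show ?thesis by (simp only: powr_add mult_ac)
    qed
    also have "real X powr (a + a + real k * a) = F * real h powr e"
    proof -
      have "real X = fact n * real h powr real n" using h by (simp add: X_def powr_realpow)
      then show ?thesis using na by (simp add: F_def powr_mult powr_powr)
    qed
    also have "2 * C1 * C2 * (F * real h powr e) * real h ^ (n * (n - 1)) =
        2 * C1 * C2 * F * real h powr ((real n)\<^sup>2 - real n + e)"
    proof -
      have "real h ^ (n * (n - 1)) = real h powr ((real n)\<^sup>2 - real n)"
        using h n by (simp add: powr_realpow[symmetric] of_nat_diff power2_eq_square algebra_simps)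
      then show ?thesis by (simp add: powr_add)
    qed
    finally show "real (card {A \<in> bounded_int_mats n (real h).
        det A \<noteq> 0 \<and> prime_factors (nat \<bar>det A\<bar>) \<subseteq> prime_factors D}) \<le>
        2 * C1 * C2 * F * real h powr ((real n)\<^sup>2 - real n + e)"
      by (simp add: M_def)
  qed
qed

section \<open>Multiplicative relations and valuations\<close>

definition power_product :: "nat \<Rightarrow> int mat list \<Rightarrow> int list \<Rightarrow> rat mat" where
  "power_product n As ks = foldr (\<lambda>X Y. X \<otimes>\<^bsub>GL_rat n\<^esub> Y)
     (map2 (\<lambda>A k. map_mat rat_of_int A [^]\<^bsub>GL_rat n\<^esub> k) As ks) \<one>\<^bsub>GL_rat n\<^esub>"

lemma power_product_Nil [simp]: "power_product n [] ks = \<one>\<^bsub>GL_rat n\<^esub>"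
  by (simp add: power_product_def)

lemma power_product_Cons [simp]: 
  "power_product n (A # As) (k # ks) =
     map_mat rat_of_int A [^]\<^bsub>GL_rat n\<^esub> k \<otimes>\<^bsub>GL_rat n\<^esub> power_product n As ks"
  by (simp add: power_product_def)

section \<open>The group of invertible rational matrices and determinants of its powers\<close>

lemma group_GL_rat: "group (GL_rat n)"
proof -
  interpret ring "ring_mat TYPE(rat) n ()" by (rule ring_mat)
  show ?thesis unfolding GL_rat_def by (rule units_group)
qed

lemma GL_rat_simps [simp]:
  "x \<otimes>\<^bsub>GL_rat n\<^esub> y = x * y" "\<one>\<^bsub>GL_rat n\<^esub> = 1\<^sub>m n"
  by (simp_all add: GL_rat_def units_of_def ring_mat_simps)

lemma carrier_GL_rat: "carrier (GL_rat n) = {X \<in> carrier_mat n n. det X \<noteq> 0}"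
proof -
  have "X \<in> carrier_mat n n" if "X \<in> Units (ring_mat TYPE(rat) n ())" for X
    using that by (simp add: Units_def ring_mat_simps)
  moreover have "det X \<noteq> 0" if "X \<in> Units (ring_mat TYPE(rat) n ())" for X
    by (rule unit_imp_det_non_zero[OF that])
  moreover have "X \<in> Units (ring_mat TYPE(rat) n ())" if "X \<in> carrier_mat n n" "det X \<noteq> 0" for X
    by (rule det_non_zero_imp_unit[OF that])
  ultimately show ?thesis unfolding GL_rat_def units_of_carrier by auto
qed

lemma det_GL_rat_pow:
  assumes "X \<in> carrier (GL_rat n)"
  shows "det (X [^]\<^bsub>GL_rat n\<^esub> (k :: int)) = det X powi k"
proof -
  interpret group "GL_rat n" by (rule group_GL_rat)
  have nat_pow: "det (X [^]\<^bsub>GL_rat n\<^esub> (m :: nat)) = det X ^ m" for m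
  proof (induction m)
    case (Suc m)
    have "X [^]\<^bsub>GL_rat n\<^esub> m \<in> carrier (GL_rat n)" using assms by simp
    then show ?case using Suc assms by (simp add: carrier_GL_rat det_mult[of _ n])
  qed simp
  have inv: "det (inv\<^bsub>GL_rat n\<^esub> Y) = inverse (det Y)" if Y: "Y \<in> carrier (GL_rat n)" for Y
  proof -
    have "inv\<^bsub>GL_rat n\<^esub> Y \<in> carrier (GL_rat n)" using Y by simp
    then have "det (inv\<^bsub>GL_rat n\<^esub> Y) * det Y = det (inv\<^bsub>GL_rat n\<^esub> Y \<otimes>\<^bsub>GL_rat n\<^esub> Y)"
      using Y by (simp add: carrier_GL_rat det_mult[of _ n])
    also have "\<dots> = 1" using l_inv[OF Y] by simp
    finally show ?thesis by (metis inverse_unique mult.commute)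
  qed
  show ?thesis
  proof (cases "k < 0")
    case True
    have "det (X [^]\<^bsub>GL_rat n\<^esub> k) = inverse (det X ^ nat (- k))"
      by (simp only: int_pow_def2 if_P[OF True] inv[OF nat_pow_closed[OF assms]] nat_pow)
    then show ?thesis using True by (simp add: power_int_def power_inverse)
  next
    case False
    then have "det (X [^]\<^bsub>GL_rat n\<^esub> k) = det X ^ nat k"
      by (simp only: int_pow_def2 if_False nat_pow)
    then show ?thesis using False by (simp add: power_int_def)
  qed
qed

lemma map_mat_in_GL_rat:
  assumes "A \<in> carrier_mat n n" "det A \<noteq> 0"
  shows "map_mat rat_of_int A \<in> carrier (GL_rat n)"
  using assms by (simp add: carrier_GL_rat of_int_hom.hom_det)

lemma power_product_carrier:
  assumes "length As = length ks" "\<And>A. A \<in> set As \<Longrightarrow> A \<in> carrier_mat n n \<and> det A \<noteq> 0"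
  shows "power_product n As ks \<in> carrier (GL_rat n)"
  using assms
proof (induction As ks rule: list_induct2)
  case Nil
  interpret group "GL_rat n" by (rule group_GL_rat)
  show ?case using one_closed by simp
next
  case (Cons A As k ks)
  interpret group "GL_rat n" by (rule group_GL_rat)
  have "map_mat rat_of_int A [^]\<^bsub>GL_rat n\<^esub> k \<in> carrier (GL_rat n)"
    using Cons.prems by (intro int_pow_closed map_mat_in_GL_rat) auto
  then show ?case using Cons m_closed unfolding power_product_Cons by simp
qed

lemma det_power_product:
  assumes "length As = length ks" "\<And>A. A \<in> set As \<Longrightarrow> A \<in> carrier_mat n n \<and> det A \<noteq> 0"
  shows "det (power_product n As ks) = prod_list (map2 (\<lambda>A k. rat_of_int (det A) powi k) As ks)"
  using assms
proof (induction As ks rule: list_induct2)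
  case (Cons A As k ks)
  interpret group "GL_rat n" by (rule group_GL_rat)
  have A: "map_mat rat_of_int A \<in> carrier (GL_rat n)" using Cons.prems by (intro map_mat_in_GL_rat) auto
  then have "map_mat rat_of_int A [^]\<^bsub>GL_rat n\<^esub> k \<in> carrier (GL_rat n)" by simp
  moreover have "power_product n As ks \<in> carrier (GL_rat n)"
    using Cons by (intro power_product_carrier) auto
  ultimately show ?case
    using Cons det_GL_rat_pow[OF A, of k] by (simp add: carrier_GL_rat det_mult[of _ n] of_int_hom.hom_det)
qed simp

text \<open>The product is rational while the valuations are those of integers, so the induction
  carries a fraction \<open>a / b\<close> together with the difference of the valuations of
  \<open>a\<close> and \<open>b\<close>. In the end \<open>a = b\<close>.\<close>

lemma sum_list_valuation_eq_0:
  fixes p :: int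
  assumes p: "prime p" and len: "length ds = length ks" and nz: "0 \<notin> set ds"
    and one: "prod_list (map2 (\<lambda>d k. rat_of_int d powi k) ds ks) = 1"
  shows "sum_list (map2 (\<lambda>d k. k * int (multiplicity p d)) ds ks) = 0"
proof -
  have "\<exists>a b. a \<noteq> 0 \<and> b \<noteq> 0 \<and>
      prod_list (map2 (\<lambda>d k. rat_of_int d powi k) ds ks) = rat_of_int a / rat_of_int b \<and>
      sum_list (map2 (\<lambda>d k. k * int (multiplicity p d)) ds ks) =
        int (multiplicity p a) - int (multiplicity p b)"
    using len nz
  proof (induction ds ks rule: list_induct2)
    case Nil
    show ?case by (intro exI[of _ 1]) simp
  next
    case (Cons d ds k ks)
    then obtain a b where ab: "a \<noteq> 0" "b \<noteq> 0"
      "prod_list (map2 (\<lambda>d k. rat_of_int d powi k) ds ks) = rat_of_int a / rat_of_int b"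
      "sum_list (map2 (\<lambda>d k. k * int (multiplicity p d)) ds ks) =
        int (multiplicity p a) - int (multiplicity p b)" by auto
    have d: "d \<noteq> 0" using Cons.prems by auto
    have pe: "prime_elem p" using p by (rule prime_imp_prime_elem)
    have 1: "rat_of_int d powi k = rat_of_int (d ^ nat k) / rat_of_int (d ^ nat (- k))"
      by (auto simp: power_int_def field_simps)
    show ?case
    proof (intro exI conjI)
      show "d ^ nat k * a \<noteq> 0" "d ^ nat (- k) * b \<noteq> 0" using d ab by auto
      show "prod_list (map2 (\<lambda>d k. rat_of_int d powi k) (d # ds) (k # ks)) =
          rat_of_int (d ^ nat k * a) / rat_of_int (d ^ nat (- k) * b)"
        using 1 ab by simp
      have "k * int (multiplicity p d) =
          int (nat k * multiplicity p d) - int (nat (- k) * multiplicity p d)"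
        by (cases "k \<ge> 0") (auto simp: algebra_simps)
      then show "sum_list (map2 (\<lambda>d k. k * int (multiplicity p d)) (d # ds) (k # ks)) =
          int (multiplicity p (d ^ nat k * a)) - int (multiplicity p (d ^ nat (- k) * b))"
        using d ab
        by (simp add: prime_elem_multiplicity_mult_distrib[OF pe] prime_elem_multiplicity_power_distrib[OF pe])
    qed
  qed
  then obtain a b where "a \<noteq> 0" "b \<noteq> 0" "rat_of_int a / rat_of_int b = 1"
    "sum_list (map2 (\<lambda>d k. k * int (multiplicity p d)) ds ks) =
        int (multiplicity p a) - int (multiplicity p b)" using one by auto
  then show ?thesis by simp
qed

lemma valuation_of_relation:
  fixes p :: int
  assumes p: "prime p" and "length As = length ks"
    and "\<And>A. A \<in> set As \<Longrightarrow> A \<in> carrier_mat n n \<and> det A \<noteq> 0"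
    and "power_product n As ks = 1\<^sub>m n"
  shows "sum_list (map2 (\<lambda>A k. k * int (multiplicity p (det A))) As ks) = 0"
proof -
  have eq: "map2 g (map det As) ks = map2 (\<lambda>A k. g (det A) k) As ks" for g :: "int \<Rightarrow> int \<Rightarrow> 'b"
    by (simp add: zip_map1 comp_def case_prod_beta)
  have "prod_list (map2 (\<lambda>A k. rat_of_int (det A) powi k) As ks) = 1"
    using det_power_product[OF assms(2,3)] assms(4) by simp
  then have "sum_list (map2 (\<lambda>d k. k * int (multiplicity p d)) (map det As) ks) = 0"
    using assms(2,3) by (intro sum_list_valuation_eq_0[OF p]) (auto simp: eq)
  then show ?thesis by (simp add: eq)
qed

text \<open>Re-indexes the exponents of a sub-tuple by the positions of the whole tuple, with 0
  outside \<open>I\<close>. The vector \<open>K\<close> is chosen before \<open>f\<close>, so one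
  \<open>K\<close> serves the valuations at all primes simultaneously.\<close>

lemma sum_list_nths_extend:
  assumes "length (nths As I) = length ks"
  shows "\<exists>K :: nat \<Rightarrow> int. (\<forall>i. i \<notin> I \<longrightarrow> K i = 0) \<and>
    ((\<exists>k \<in> set ks. k \<noteq> 0) \<longrightarrow> (\<exists>i<length As. K i \<noteq> 0)) \<and>
    (\<forall>f. sum_list (map2 (\<lambda>A k. k * f A) (nths As I) ks) = (\<Sum>i<length As. K i * f (As ! i)))"
  using assms
proof (induction As arbitrary: I ks)
  case Nil
  then show ?case by (intro exI[of _ "\<lambda>_. 0"]) auto
next
  case (Cons A As)
  define I' where "I' = {j. Suc j \<in> I}"
  define k0 where "k0 = (if 0 \<in> I then hd ks else 0)"
  define ks' where "ks' = (if 0 \<in> I then tl ks else ks)"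
  have ks: "0 \<in> I \<Longrightarrow> ks = k0 # ks'" "0 \<notin> I \<Longrightarrow> ks = ks'"
    using Cons.prems by (auto simp: k0_def ks'_def nths_Cons neq_Nil_conv intro: list.exhaust[of ks])
  have "length (nths As I') = length ks'"
    using Cons.prems ks by (cases "0 \<in> I") (auto simp: nths_Cons I'_def)
  from Cons.IH[OF this] obtain K where K': "(\<forall>i. i \<notin> I' \<longrightarrow> K i = 0) \<and>
    ((\<exists>k \<in> set ks'. k \<noteq> 0) \<longrightarrow> (\<exists>i<length As. K i \<noteq> 0)) \<and>
    (\<forall>f. sum_list (map2 (\<lambda>A k. k * f A) (nths As I') ks') = (\<Sum>i<length As. K i * f (As ! i)))" ..
  note K = K'[THEN conjunct1, rule_format] K'[THEN conjunct2, THEN conjunct1, rule_format]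
    K'[THEN conjunct2, THEN conjunct2, rule_format]
  show ?case
  proof (intro exI[of _ "case_nat k0 K"] conjI allI impI)
    fix i assume "i \<notin> I"
    then show "case_nat k0 K i = 0" using K(1) by (auto simp: k0_def I'_def split: nat.split)
  next
    assume "\<exists>k\<in>set ks. k \<noteq> 0"
    then consider "k0 \<noteq> 0" | "\<exists>k\<in>set ks'. k \<noteq> 0" using ks by (cases "0 \<in> I") auto
    then show "\<exists>i<length (A # As). case_nat k0 K i \<noteq> 0"
    proof cases
      case 1
      then show ?thesis by (intro exI[of _ 0]) simp
    next
      case 2
      then obtain i where "i < length As" "K i \<noteq> 0" using K(2) by blast
      then show ?thesis by (intro exI[of _ "Suc i"]) simp
    qed
  next
    fix f
    have "(\<Sum>i<length (A # As). case_nat k0 K i * f ((A # As) ! i)) =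
        k0 * f A + (\<Sum>i<length As. K i * f (As ! i))"
      by (simp add: sum.lessThan_Suc_shift del: sum.lessThan_Suc)
    also have "\<dots> = sum_list (map2 (\<lambda>A k. k * f A) (nths (A # As) I) ks)"
    proof (cases "0 \<in> I")
      case True
      show ?thesis unfolding ks(1)[OF True] using True K(3)[of f] by (simp add: nths_Cons I'_def)
    next
      case False
      have "k0 = 0" using False by (simp add: k0_def)
      then show ?thesis unfolding ks(2)[OF False] using False K(3)[of f] by (simp add: nths_Cons I'_def)
    qed
    finally show "sum_list (map2 (\<lambda>A k. k * f A) (nths (A # As) I) ks) =
        (\<Sum>i<length (A # As). case_nat k0 K i * f ((A # As) ! i))" by simp
  qed
qed

lemma mult_dependent_valuation:
  assumes dep: "mult_dependent n (nths As I)"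
    and As: "\<And>A. A \<in> set As \<Longrightarrow> A \<in> carrier_mat n n \<and> det A \<noteq> 0"
  obtains K i where "i < length As" "K i \<noteq> 0" "\<And>i. i \<notin> I \<Longrightarrow> K i = 0"
    "\<And>p. prime p \<Longrightarrow> (\<Sum>i<length As. K i * int (multiplicity p (det (As ! i)))) = 0"
proof -
  obtain ks where ks: "length ks = length (nths As I)" "\<exists>k \<in> set ks. k \<noteq> 0"
    "power_product n (nths As I) ks = 1\<^sub>m n"
    using dep by (auto simp: mult_dependent_def power_product_def)
  obtain K where K': "(\<forall>i. i \<notin> I \<longrightarrow> K i = 0) \<and>
    ((\<exists>k \<in> set ks. k \<noteq> 0) \<longrightarrow> (\<exists>i<length As. K i \<noteq> 0)) \<and>
    (\<forall>f. sum_list (map2 (\<lambda>A k. k * f A) (nths As I) ks) = (\<Sum>i<length As. K i * f (As ! i)))"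
    using sum_list_nths_extend[OF ks(1)[symmetric]] ..
  note K = K'[THEN conjunct1, rule_format] K'[THEN conjunct2, THEN conjunct1, rule_format, OF ks(2)]
    K'[THEN conjunct2, THEN conjunct2, rule_format]
  have "(\<Sum>i<length As. K i * int (multiplicity p (det (As ! i)))) = 0" if "prime p" for p
    unfolding K(3)[of "\<lambda>A. int (multiplicity p (det A))", symmetric]
    by (rule valuation_of_relation[OF that _ _ ks(3)]) (use As ks in \<open>auto dest: in_set_nthsD\<close>)
  then show ?thesis using that K by blast
qed

lemma nths_support:
  assumes "length As = length ks"
  shows "nths As {i. i < length ks \<and> ks ! i \<noteq> (0 :: int)} = map fst (filter (\<lambda>x. snd x \<noteq> 0) (zip As ks))"
  using assms
proof (induction As ks rule: list_induct2)
  case (Cons A As k ks)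
  have "{j. Suc j < length (k # ks) \<and> (k # ks) ! Suc j \<noteq> 0} = {i. i < length ks \<and> ks ! i \<noteq> 0}" by auto
  then show ?case using Cons by (simp add: nths_Cons)
qed simp

lemma power_product_support:
  assumes "length As = length ks" "\<And>A. A \<in> set As \<Longrightarrow> A \<in> carrier_mat n n \<and> det A \<noteq> 0"
  defines "Z \<equiv> filter (\<lambda>x. snd x \<noteq> 0) (zip As ks)"
  shows "power_product n (map fst Z) (map snd Z) = power_product n As ks"
  using assms(1,2) unfolding Z_def
proof (induction As ks rule: list_induct2)
  case (Cons A As k ks)
  interpret group "GL_rat n" by (rule group_GL_rat)
  have "power_product n As ks \<in> carrier (GL_rat n)"
    using Cons by (intro power_product_carrier) auto
  then have "1\<^sub>m n * power_product n As ks = power_product n As ks"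
    by (auto simp: carrier_GL_rat intro!: left_mult_one_mat)
  then show ?case using Cons int_pow_0[of "GL_rat n" "map_mat rat_of_int A"] by auto
qed simp

lemma minimal_dependent_relation:
  assumes "As \<in> minimal_dependent_tuples n s H"
  obtains ks where "length ks = s" "\<And>i. i < s \<Longrightarrow> ks ! i \<noteq> 0" "power_product n As ks = 1\<^sub>m n"
proof -
  have len: "length As = s" and As: "\<And>A. A \<in> set As \<Longrightarrow> A \<in> carrier_mat n n \<and> det A \<noteq> 0"
    and dep: "mult_dependent n As" and min: "\<And>I. I \<subset> {..<s} \<Longrightarrow> \<not> mult_dependent n (nths As I)"
    using assms by (auto simp: minimal_dependent_tuples_def dependent_tuples_def bounded_int_mats_def)
  obtain ks where ks: "length ks = length As" "\<exists>k \<in> set ks. k \<noteq> 0" "power_product n As ks = 1\<^sub>m n"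
    using dep by (auto simp: mult_dependent_def power_product_def)
  have "ks ! i \<noteq> 0" if i: "i < s" for i
  proof
    assume z: "ks ! i = 0"
    define I where "I = {i. i < length ks \<and> ks ! i \<noteq> 0}"
    define Z where "Z = filter (\<lambda>x. snd x \<noteq> 0) (zip As ks)"
    have "I \<subset> {..<s}" using i z ks len by (auto simp: I_def)
    moreover have "mult_dependent n (nths As I)"
    proof -
      have "nths As I = map fst Z" using nths_support[of As ks] ks(1) by (simp add: I_def Z_def)
      moreover have "power_product n (map fst Z) (map snd Z) = 1\<^sub>m n"
        unfolding Z_def using power_product_support[of As ks n] ks As by simp
      moreover have "\<exists>k\<in>set (map snd Z). k \<noteq> 0"
      proof -
        obtain j where "j < length ks" "ks ! j \<noteq> 0" using ks(2) by (auto simp: in_set_conv_nth)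
        then have "(As ! j, ks ! j) \<in> set Z" using ks(1) by (auto simp: Z_def in_set_zip)
        then show ?thesis using \<open>ks ! j \<noteq> 0\<close> by force
      qed
      ultimately show ?thesis
        unfolding mult_dependent_def power_product_def
        by (intro exI[of _ "map snd Z"]) simp
    qed
    ultimately show False using min by blast
  qed
  then show ?thesis using that ks len by metis
qed

section \<open>The upper bound\<close>

text \<open>The sign \<open>\<sigma>\<close> treats both sign classes at once. If \<open>p\<close>
  divided no determinant over \<open>J\<close>, every term of the valuation equation multiplied by
  \<open>\<sigma>\<close> would be non-negative and the one at \<open>i\<close> positive, so they
  could not sum to 0.\<close>

lemma relation_prime_support:
  fixes \<sigma> :: int
  assumes "length As = s" "length ks = s"
    and As: "\<And>A. A \<in> set As \<Longrightarrow> A \<in> carrier_mat n n \<and> det A \<noteq> 0"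
    and rel: "power_product n As ks = 1\<^sub>m n"
    and i: "i < s" "\<sigma> * ks ! i > 0"
  defines "J \<equiv> {j. j < s \<and> \<sigma> * ks ! j < 0}"
  shows "prime_factors (nat \<bar>det (As ! i)\<bar>) \<subseteq> prime_factors (\<Prod>j\<in>J. nat \<bar>det (As ! j)\<bar>)"
proof
  fix p assume p: "p \<in> prime_factors (nat \<bar>det (As ! i)\<bar>)"
  then have prime: "prime p" and "p dvd nat \<bar>det (As ! i)\<bar>" by auto
  then have pi: "int p dvd det (As ! i)" by (simp add: dvd_nat_abs_iff)
  have pp: "prime (int p)" using prime by simp
  have finJ: "finite J" by (simp add: J_def)
  have nz: "det (As ! j) \<noteq> 0" if "j < s" for j using As assms(1) that by auto
  define v where "v = (\<lambda>j. int (multiplicity (int p) (det (As ! j))))"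
  have "(\<Sum>j<s. ks ! j * v j) = sum_list (map2 (\<lambda>A k. k * int (multiplicity (int p) (det A))) As ks)"
    using assms(1,2) by (simp add: sum_list_sum_nth v_def lessThan_atLeast0)
  also have "\<dots> = 0"
    using assms(1,2) by (intro valuation_of_relation[OF pp _ As rel]) auto
  finally have "\<sigma> * (\<Sum>j<s. ks ! j * v j) = 0" by simp
  then have sum0: "(\<Sum>j<s. \<sigma> * ks ! j * v j) = 0" by (simp add: sum_distrib_left mult.assoc)
  have "\<exists>j\<in>J. int p dvd det (As ! j)"
  proof (rule ccontr)
    assume neg: "\<not> ?thesis"
    have "0 \<le> \<sigma> * ks ! j * v j" if "j < s" for j
    proof (cases "j \<in> J")
      case True
      then have "v j = 0" using neg by (auto simp: v_def not_dvd_imp_multiplicity_0)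
      then show ?thesis by simp
    next
      case False
      then show ?thesis using that by (auto simp: J_def v_def)
    qed
    then have "\<sigma> * ks ! i * v i \<le> (\<Sum>j<s. \<sigma> * ks ! j * v j)"
      using i(1) by (intro member_le_sum) auto
    moreover have "v i > 0"
      using pi nz[OF i(1)] prime_multiplicity_gt_zero_iff[OF prime_imp_prime_elem[OF pp]] by (simp add: v_def)
    then have "\<sigma> * ks ! i * v i > 0" using i(2) by (rule mult_pos_pos[rotated])
    ultimately show False using sum0 by linarith
  qed
  then obtain j where j: "j \<in> J" "p dvd nat \<bar>det (As ! j)\<bar>" by (auto simp: dvd_nat_abs_iff)
  have "p dvd (\<Prod>j\<in>J. nat \<bar>det (As ! j)\<bar>)"
    using j(2) dvd_prodI[OF finJ j(1), of "\<lambda>j. nat \<bar>det (As ! j)\<bar>"] by (rule dvd_trans)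
  moreover have "(\<Prod>j\<in>J. nat \<bar>det (As ! j)\<bar>) \<noteq> 0"
    using finJ nz by (auto simp: J_def)
  ultimately show "p \<in> prime_factors (\<Prod>j\<in>J. nat \<bar>det (As ! j)\<bar>)"
    using prime by (simp add: in_prime_factors_iff)
qed

text \<open>What remains of a relation when the exponents, an infinite set of choices, are
  forgotten. For empty \<open>J\<close> the product is 1 and all determinants are \<open>1\<close>
  or \<open>-1\<close>.\<close>

definition supported_tuples :: "nat \<Rightarrow> nat \<Rightarrow> nat \<Rightarrow> nat set \<Rightarrow> int mat list set" where
  "supported_tuples n s h J = {As. length As = s \<and>
     (\<forall>i<s. As ! i \<in> bounded_int_mats n (real h) \<and> det (As ! i) \<noteq> 0) \<and>
     (\<forall>i\<in>{..<s} - J. prime_factors (nat \<bar>det (As ! i)\<bar>) \<subseteq> prime_factors (\<Prod>j\<in>J. nat \<bar>det (As ! j)\<bar>))}"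

lemma minimal_dependent_tuples_subset:
  "minimal_dependent_tuples n s (real h) \<subseteq>
     (\<Union>J\<in>{J. J \<subseteq> {..<s} \<and> 2 * card J \<le> s}. supported_tuples n s h J)"
proof
  fix As assume min: "As \<in> minimal_dependent_tuples n s (real h)"
  then have len: "length As = s"
    and box: "\<And>A. A \<in> set As \<Longrightarrow> A \<in> bounded_int_mats n (real h) \<and> det A \<noteq> 0"
    by (auto simp: minimal_dependent_tuples_def dependent_tuples_def)
  have As: "\<And>A. A \<in> set As \<Longrightarrow> A \<in> carrier_mat n n \<and> det A \<noteq> 0"
    using box by (auto simp: bounded_int_mats_def)
  obtain ks where ks: "length ks = s" "\<And>i. i < s \<Longrightarrow> ks ! i \<noteq> 0" "power_product n As ks = 1\<^sub>m n"
    using minimal_dependent_relation[OF min] by metis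
  define J where "J = (\<lambda>\<sigma> :: int. {j. j < s \<and> \<sigma> * ks ! j < 0})"
  have "card (J 1) + card (J (- 1)) = card (J 1 \<union> J (- 1))"
    by (rule card_Un_disjoint[symmetric]) (auto simp: J_def)
  also have "J 1 \<union> J (- 1) = {..<s}" using ks(2) by (force simp: J_def)
  finally have "2 * card (J 1) \<le> s \<or> 2 * card (J (- 1)) \<le> s" by auto
  then obtain \<sigma> where \<sigma>: "\<sigma> = 1 \<or> \<sigma> = - 1" "2 * card (J \<sigma>) \<le> s" by blast
  have "As \<in> supported_tuples n s h (J \<sigma>)"
    unfolding supported_tuples_def
  proof (intro CollectI conjI ballI)
    fix i assume "i \<in> {..<s} - J \<sigma>"
    then have "i < s" "\<sigma> * ks ! i > 0" using ks(2)[of i] \<sigma> by (auto simp: J_def)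
    then show "prime_factors (nat \<bar>det (As ! i)\<bar>) \<subseteq> prime_factors (\<Prod>j\<in>J \<sigma>. nat \<bar>det (As ! j)\<bar>)"
      unfolding J_def using relation_prime_support[OF len ks(1) As ks(3)] by blast
  qed (use len box in auto)
  moreover have "J \<sigma> \<subseteq> {..<s}" by (auto simp: J_def)
  ultimately show "As \<in> (\<Union>J\<in>{J. J \<subseteq> {..<s} \<and> 2 * card J \<le> s}. supported_tuples n s h J)"
    using \<sigma>(2) by blast
qed

text \<open>The entries over \<open>J\<close> are chosen first; they determine \<open>D\<close>, and
  each remaining entry lies in a set depending on \<open>D\<close> alone. Hence the bound
  \<open>M\<close> has to be uniform in \<open>D\<close>, up to the size of a product of at most
  \<open>s\<close> determinants.\<close>

lemma card_supported_tuples_le: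
  fixes M :: real
  assumes J: "J \<subseteq> {..<s}" and h: "h \<ge> 1"
    and M: "\<And>D. D > 0 \<Longrightarrow> D \<le> (fact n * h ^ n) ^ s \<Longrightarrow>
      real (card {A \<in> bounded_int_mats n (real h).
        det A \<noteq> 0 \<and> prime_factors (nat \<bar>det A\<bar>) \<subseteq> prime_factors D}) \<le> M"
  shows "finite (supported_tuples n s h J)"
    and "real (card (supported_tuples n s h J)) \<le> real ((2 * h + 1) ^ n\<^sup>2) ^ card J * M ^ (s - card J)"
proof -
  define B where "B = {A \<in> bounded_int_mats n (real h). det A \<noteq> 0}"
  define S where "S = (\<lambda>D. {A \<in> bounded_int_mats n (real h).
        det A \<noteq> 0 \<and> prime_factors (nat \<bar>det A\<bar>) \<subseteq> prime_factors D})"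
  define I where "I = {..<s} - J"
  define D where "D = (\<lambda>f :: nat \<Rightarrow> int mat. \<Prod>j\<in>J. nat \<bar>det (f j)\<bar>)"
  define T where "T = Sigma (Pi\<^sub>E J (\<lambda>_. B)) (\<lambda>f. Pi\<^sub>E I (\<lambda>_. S (D f)))"
  define \<Phi> where "\<Phi> = (\<lambda>As :: int mat list. (restrict ((!) As) J, restrict ((!) As) I))"
  have fJ: "finite J" using J finite_subset by blast
  have fin: "finite B" "finite (S d)" "finite I" for d
    using finite_bounded_int_mats[of n h] by (auto simp: B_def S_def I_def)
  have fB: "finite (Pi\<^sub>E J (\<lambda>_. B))" using fJ fin by (intro finite_PiE) auto
  have fT: "finite T" unfolding T_def using fin by (intro finite_SigmaI fB finite_PiE) auto
  have inj: "inj_on \<Phi> (supported_tuples n s h J)"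
  proof (rule inj_onI)
    fix As Bs assume As: "As \<in> supported_tuples n s h J" and Bs: "Bs \<in> supported_tuples n s h J"
      and eq: "\<Phi> As = \<Phi> Bs"
    have e: "restrict ((!) As) J = restrict ((!) Bs) J" "restrict ((!) As) I = restrict ((!) Bs) I"
      using eq by (auto simp: \<Phi>_def)
    have "As ! i = Bs ! i" if "i < s" for i
      using fun_cong[OF e(1), of i] fun_cong[OF e(2), of i] that by (cases "i \<in> J") (auto simp: I_def)
    then show "As = Bs" using As Bs by (intro nth_equalityI) (auto simp: supported_tuples_def)
  qed
  have img: "\<Phi> ` supported_tuples n s h J \<subseteq> T"
  proof (rule image_subsetI)
    fix As assume As: "As \<in> supported_tuples n s h J"
    have "D (restrict ((!) As) J) = (\<Prod>j\<in>J. nat \<bar>det (As ! j)\<bar>)" 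
      unfolding D_def by (intro prod.cong) auto
    then show "\<Phi> As \<in> T" using As J
      by (auto simp: T_def \<Phi>_def supported_tuples_def B_def S_def I_def)
  qed
  show "finite (supported_tuples n s h J)" using finite_imageD[OF finite_subset[OF img fT] inj] .
  have X1: "1 \<le> fact n * h ^ n"
  proof -
    have "fact n * h ^ n > 0" using h by simp
    then show ?thesis by linarith
  qed
  have cardS: "real (card (S (D f))) \<le> M" if f: "f \<in> Pi\<^sub>E J (\<lambda>_. B)" for f
  proof -
    have fj: "f j \<in> B" if "j \<in> J" for j using f that by auto
    have "D f > 0" unfolding D_def using fj by (intro prod_pos) (auto simp: B_def)
    moreover have "D f \<le> (\<Prod>j\<in>J. fact n * h ^ n)"
      unfolding D_def using fj abs_det_bounded_int_mats by (intro prod_mono) (auto simp: B_def)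
    moreover have "(\<Prod>j\<in>J. fact n * h ^ n) \<le> (fact n * h ^ n) ^ s"
    proof -
      have "card J \<le> s" using card_mono[OF _ J] by simp
      then show ?thesis unfolding prod_constant by (rule power_increasing[OF _ X1])
    qed
    ultimately show ?thesis unfolding S_def using M order.trans by blast
  qed
  have cI: "card I = s - card J" using J fJ by (simp add: I_def card_Diff_subset)
  have "real (card (supported_tuples n s h J)) \<le> real (card T)"
    using card_inj_on_le[OF inj img fT] by simp
  also have "card T = (\<Sum>f\<in>Pi\<^sub>E J (\<lambda>_. B). card (S (D f)) ^ card I)"
    unfolding T_def using fB fin by (subst card_SigmaI) (auto simp: card_PiE intro!: finite_PiE)
  also have "real \<dots> = (\<Sum>f\<in>Pi\<^sub>E J (\<lambda>_. B). real (card (S (D f))) ^ card I)" by simp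
  also have "\<dots> \<le> (\<Sum>f\<in>Pi\<^sub>E J (\<lambda>_. B). M ^ card I)"
    using cardS by (intro sum_mono power_mono) auto
  also have "\<dots> = real (card B) ^ card J * M ^ card I" using fJ by (simp add: card_PiE)
  also have "\<dots> \<le> real ((2 * h + 1) ^ n\<^sup>2) ^ card J * M ^ card I"
  proof (intro mult_right_mono power_mono)
    have "card B \<le> card (bounded_int_mats n (real h))"
      by (intro card_mono finite_bounded_int_mats) (auto simp: B_def)
    then show "real (card B) \<le> real ((2 * h + 1) ^ n\<^sup>2)"
      unfolding of_nat_le_iff using card_bounded_int_mats_le[of n h] by linarith
    \<comment> \<open>The case \<open>D = 1\<close> shows \<open>M \<ge> 0\<close>, also when no
      entry can be chosen over \<open>J\<close>.\<close>
    have "M \<ge> real (card (S 1))" unfolding S_def using X1 by (intro M) auto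
    then have "M \<ge> 0" by (rule order.trans[rotated]) simp
    then show "0 \<le> M ^ card I" by simp
  qed simp
  finally show "real (card (supported_tuples n s h J)) \<le> real ((2 * h + 1) ^ n\<^sup>2) ^ card J * M ^ (s - card J)"
    by (simp add: cI)
qed

lemma ceiling_half_le:
  assumes "2 * c \<le> (s :: nat)"
  shows "real_of_int \<lceil>real s / 2\<rceil> \<le> real s - real c"
proof -
  have "\<lceil>real s / 2\<rceil> \<le> int s - int c" using assms by (intro ceiling_le) simp
  then show ?thesis by linarith
qed

text \<open>Each of the \<open>s - card J \<ge> \<lceil>s / 2\<rceil>\<close> positions outside
  \<open>J\<close> has exponent \<open>n\<^sup>2 - n + e\<close> instead of
  \<open>n\<^sup>2\<close>. The at most \<open>2 ^ s\<close> choices of \<open>J\<close> only affect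
  the constant.\<close>

lemma card_minimal_dependent_tuples_le:
  assumes e: "e > 0" and n: "n \<ge> 1"
  obtains C where "C > 0" "\<And>h. h \<ge> 1 \<Longrightarrow>
    real (card (minimal_dependent_tuples n s (real h))) \<le>
      C * real h powr (real s * (real n)\<^sup>2 - real_of_int \<lceil>real s / 2\<rceil> * real n + real s * e)"
proof -
  obtain C0 where C0: "C0 > 0" "\<And>h D. h \<ge> 1 \<Longrightarrow> D > 0 \<Longrightarrow> D \<le> (fact n * h ^ n) ^ s \<Longrightarrow>
    real (card {A \<in> bounded_int_mats n (real h).
        det A \<noteq> 0 \<and> prime_factors (nat \<bar>det A\<bar>) \<subseteq> prime_factors D}) \<le>
      C0 * real h powr ((real n)\<^sup>2 - real n + e)"
    using card_det_smooth_le[OF e n, of s] by auto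
  \<comment> \<open>At least 1, so that \<open>C1 ^ (s - card J)\<close> is bounded by
    \<open>C1 ^ s\<close> whatever \<open>J\<close> is.\<close>
  define C1 where "C1 = max 1 C0"
  define E where "E = real s * (real n)\<^sup>2 - real_of_int \<lceil>real s / 2\<rceil> * real n + real s * e"
  define K where "K = (3 ^ n\<^sup>2) ^ s * C1 ^ s"
  have C1: "C1 \<ge> 1" "C1 \<ge> C0" by (auto simp: C1_def)
  show ?thesis
  proof (rule that[of "2 ^ s * K"])
    show "2 ^ s * K > 0" using C1 by (simp add: K_def)
    fix h :: nat assume h: "h \<ge> 1"
    let ?JJ = "{J. J \<subseteq> {..<s} \<and> 2 * card J \<le> s}"
    define M where "M = C1 * real h powr ((real n)\<^sup>2 - real n + e)"
    have M: "real (card {A \<in> bounded_int_mats n (real h).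
        det A \<noteq> 0 \<and> prime_factors (nat \<bar>det A\<bar>) \<subseteq> prime_factors D}) \<le> M"
      if "D > 0" "D \<le> (fact n * h ^ n) ^ s" for D
    proof -
      have "C0 * real h powr ((real n)\<^sup>2 - real n + e) \<le> M"
        unfolding M_def using C1 by (intro mult_right_mono) auto
      then show ?thesis using C0(2)[OF h that] by linarith
    qed
    have fJJ: "finite ?JJ" by (rule finite_subset[of _ "Pow {..<s}"]) auto
    have each: "real (card (supported_tuples n s h J)) \<le> K * real h powr E" if "J \<in> ?JJ" for J
    proof -
      have J: "J \<subseteq> {..<s}" "2 * card J \<le> s" using that by auto
      then have cJ: "card J \<le> s" by simp
      have "real (card (supported_tuples n s h J)) \<le> real ((2 * h + 1) ^ n\<^sup>2) ^ card J * M ^ (s - card J)"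
        by (rule card_supported_tuples_le(2)[OF J(1) h M])
      also have "\<dots> \<le> ((3 * real h) ^ n\<^sup>2) ^ card J * M ^ (s - card J)"
      proof (intro mult_right_mono power_mono)
        have "real (2 * h + 1) \<le> 3 * real h" using h by simp
        then have "real (2 * h + 1) ^ n\<^sup>2 \<le> (3 * real h) ^ n\<^sup>2" by (intro power_mono) auto
        then show "real ((2 * h + 1) ^ n\<^sup>2) \<le> (3 * real h) ^ n\<^sup>2" by simp
      qed (use C1 in \<open>auto simp: M_def\<close>)
      also have "\<dots> = (3 ^ n\<^sup>2) ^ card J * C1 ^ (s - card J) *
          ((real h ^ n\<^sup>2) ^ card J * (real h powr ((real n)\<^sup>2 - real n + e)) ^ (s - card J))"
        by (simp add: M_def power_mult_distrib mult_ac)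
      also have "(real h ^ n\<^sup>2) ^ card J * (real h powr ((real n)\<^sup>2 - real n + e)) ^ (s - card J) =
          real h powr (real (card J) * (real n)\<^sup>2 + (real s - real (card J)) * ((real n)\<^sup>2 - real n + e))"
      proof -
        have "(real h ^ n\<^sup>2) ^ card J = real h powr (real (card J) * (real n)\<^sup>2)"
          using h by (simp add: powr_realpow[symmetric] powr_powr mult.commute)
        moreover have "(real h powr ((real n)\<^sup>2 - real n + e)) ^ (s - card J) =
            real h powr ((real s - real (card J)) * ((real n)\<^sup>2 - real n + e))"
          using h cJ by (simp add: powr_realpow[symmetric] powr_powr mult.commute of_nat_diff)
        ultimately show ?thesis by (simp only: powr_add)
      qed
      also have "(3 ^ n\<^sup>2) ^ card J * C1 ^ (s - card J) *
          real h powr (real (card J) * (real n)\<^sup>2 + (real s - real (card J)) * ((real n)\<^sup>2 - real n + e)) \<le>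
          K * real h powr E"
      proof (intro mult_mono)
        show "(3 ^ n\<^sup>2) ^ card J * C1 ^ (s - card J) \<le> K"
          unfolding K_def using C1 cJ by (intro mult_mono power_increasing) auto
        have "real (card J) * (real n)\<^sup>2 + (real s - real (card J)) * ((real n)\<^sup>2 - real n + e) =
            real s * (real n)\<^sup>2 - (real s - real (card J)) * real n + (real s - real (card J)) * e"
          by (simp add: algebra_simps)
        also have "\<dots> \<le> E" unfolding E_def
        proof (intro add_mono diff_mono)
          show "real_of_int \<lceil>real s / 2\<rceil> * real n \<le> (real s - real (card J)) * real n"
            using ceiling_half_le[OF J(2)] by (intro mult_right_mono) auto
          show "(real s - real (card J)) * e \<le> real s * e" using e by (intro mult_right_mono) auto
        qed simp
        finally show "real h powr (real (card J) * (real n)\<^sup>2 +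
            (real s - real (card J)) * ((real n)\<^sup>2 - real n + e)) \<le> real h powr E"
          using h by (intro powr_mono) auto
      qed (use C1 in \<open>auto simp: K_def\<close>)
      finally show ?thesis .
    qed
    have "real (card (minimal_dependent_tuples n s (real h))) \<le>
        real (card (\<Union>J\<in>?JJ. supported_tuples n s h J))"
      unfolding of_nat_le_iff
      using fJJ card_supported_tuples_le(1)[OF _ h M]
      by (intro card_mono[OF _ minimal_dependent_tuples_subset]) auto
    also have "\<dots> \<le> real (\<Sum>J\<in>?JJ. card (supported_tuples n s h J))"
      unfolding of_nat_le_iff by (rule card_UN_le[OF fJJ])
    also have "\<dots> = (\<Sum>J\<in>?JJ. real (card (supported_tuples n s h J)))" by simp
    also have "\<dots> \<le> (\<Sum>J\<in>?JJ. K * real h powr E)" by (intro sum_mono each)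
    also have "\<dots> = real (card ?JJ) * (K * real h powr E)" by simp
    also have "\<dots> \<le> 2 ^ s * (K * real h powr E)"
    proof (intro mult_right_mono)
      have "card ?JJ \<le> card (Pow {..<s})" by (intro card_mono) auto
      then have "card ?JJ \<le> 2 ^ s" by (simp add: card_Pow)
      then show "real (card ?JJ) \<le> 2 ^ s" by (metis of_nat_le_iff of_nat_numeral of_nat_power)
    qed (use C1 in \<open>auto simp: K_def\<close>)
    finally show "real (card (minimal_dependent_tuples n s (real h))) \<le> 2 ^ s * K *
        real h powr (real s * (real n)\<^sup>2 - real_of_int \<lceil>real s / 2\<rceil> * real n + real s * e)"
      by (simp add: E_def mult.assoc)
  qed
qed

lemma bounded_int_mats_floor:
  assumes "H \<ge> 0"
  shows "bounded_int_mats n (real (nat \<lfloor>H\<rfloor>)) = bounded_int_mats n H"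
proof -
  have "\<bar>real_of_int a\<bar> \<le> real (nat \<lfloor>H\<rfloor>) \<longleftrightarrow> \<bar>real_of_int a\<bar> \<le> H" for a
    using assms by (simp add: le_floor_iff[symmetric] flip: of_int_abs)
  then show ?thesis by (simp add: bounded_int_mats_def)
qed

section \<open>The lower bound\<close>

text \<open>The inverse of \<open>a Z\<close> meets \<open>b Z\<close> directly, so \<open>Z\<close>
  cancels and a scalar remains, which commutes with everything. The factor \<open>Y\<close> stands
  for the rest of the right-nested product.\<close>

lemma smult_inverse_pair:
  fixes Z :: "int mat" and Y :: "rat mat" and a b :: int
  assumes Z: "Z \<in> carrier_mat n n" "det Z \<noteq> 0" and ab: "a \<noteq> 0" "b \<noteq> 0" and Y: "Y \<in> carrier_mat n n"
  shows "map_mat rat_of_int (a \<cdot>\<^sub>m Z) [^]\<^bsub>GL_rat n\<^esub> (- 1 :: int) \<otimes>\<^bsub>GL_rat n\<^esub>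
      (map_mat rat_of_int (b \<cdot>\<^sub>m Z) [^]\<^bsub>GL_rat n\<^esub> (1 :: int) \<otimes>\<^bsub>GL_rat n\<^esub> Y) =
    (rat_of_int b / rat_of_int a) \<cdot>\<^sub>m Y"
proof -
  interpret group "GL_rat n" by (rule group_GL_rat)
  define U where "U = map_mat rat_of_int (a \<cdot>\<^sub>m Z)"
  define V where "V = map_mat rat_of_int (b \<cdot>\<^sub>m Z)"
  have U: "U \<in> carrier (GL_rat n)" and V: "V \<in> carrier (GL_rat n)"
    unfolding U_def V_def using Z ab by (auto intro!: map_mat_in_GL_rat simp: det_smult)
  define W where "W = inv\<^bsub>GL_rat n\<^esub> U"
  have W: "W \<in> carrier_mat n n" using inv_closed[OF U] by (simp add: W_def carrier_GL_rat)
  have WU: "W * U = 1\<^sub>m n" using l_inv[OF U] by (simp add: W_def)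
  have Uc: "U \<in> carrier_mat n n" using U by (simp add: carrier_GL_rat)
  have pows: "U [^]\<^bsub>GL_rat n\<^esub> (- 1 :: int) = W" "V [^]\<^bsub>GL_rat n\<^esub> (1 :: int) = V"
    using int_pow_1[OF V] int_pow_neg[OF U, of 1] int_pow_1[OF U] by (simp_all add: W_def)
  have VU: "V = (rat_of_int b / rat_of_int a) \<cdot>\<^sub>m U"
    using ab Z by (intro eq_matI) (auto simp: U_def V_def)
  have UY: "U * Y \<in> carrier_mat n n" using Uc Y by simp
  have "W * (V * Y) = (rat_of_int b / rat_of_int a) \<cdot>\<^sub>m (W * (U * Y))"
    unfolding VU mult_smult_assoc_mat[OF Uc Y] mult_smult_distrib[OF W UY] ..
  also have "W * (U * Y) = Y"
    using assoc_mult_mat[OF W Uc Y] WU Y by simp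
  finally show ?thesis unfolding U_def[symmetric] V_def[symmetric] pows by simp
qed

lemma power_product_pairs:
  assumes "\<And>i. i < m \<Longrightarrow> Z i \<in> carrier_mat n n \<and> det (Z i) \<noteq> 0 \<and> a i \<noteq> 0 \<and> b i \<noteq> 0 \<and>
      F (2 * i) = a i \<cdot>\<^sub>m Z i \<and> F (2 * i + 1) = b i \<cdot>\<^sub>m Z i"
    and "length rest = length ks" "\<And>A. A \<in> set rest \<Longrightarrow> A \<in> carrier_mat n n \<and> det A \<noteq> 0"
  shows "power_product n (map F [0..<2 * m] @ rest) (map (\<lambda>i. if even i then - 1 else 1) [0..<2 * m] @ ks) =
    (\<Prod>i<m. rat_of_int (b i) / rat_of_int (a i)) \<cdot>\<^sub>m power_product n rest ks"
  using assms
proof (induction m arbitrary: rest ks)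
  case 0
  have "1 \<cdot>\<^sub>m M = M" for M :: "rat mat" by (intro eq_matI) auto
  then show ?case by simp
next
  case (Suc m)
  let ?sg = "\<lambda>i :: nat. if even i then - 1 else 1 :: int"
  have m: "Z m \<in> carrier_mat n n" "det (Z m) \<noteq> 0" "a m \<noteq> 0" "b m \<noteq> 0"
    "F (2 * m) = a m \<cdot>\<^sub>m Z m" "F (2 * m + 1) = b m \<cdot>\<^sub>m Z m" using Suc.prems(1)[of m] by auto
  have rest: "power_product n rest ks \<in> carrier_mat n n"
    using power_product_carrier[OF Suc.prems(2,3)] by (simp add: carrier_GL_rat)
  have split: "[0..<2 * Suc m] = [0..<2 * m] @ [2 * m, 2 * m + 1]" by simp
  \<comment> \<open>The last pair is moved into the remainder, to which the induction hypothesis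
    applies.\<close>
  have "power_product n (map F [0..<2 * Suc m] @ rest) (map ?sg [0..<2 * Suc m] @ ks) =
      power_product n (map F [0..<2 * m] @ (F (2 * m) # F (2 * m + 1) # rest))
        (map ?sg [0..<2 * m] @ (- 1 # 1 # ks))"
    unfolding split by simp
  also have "\<dots> = (\<Prod>i<m. rat_of_int (b i) / rat_of_int (a i)) \<cdot>\<^sub>m
      power_product n (F (2 * m) # F (2 * m + 1) # rest) (- 1 # 1 # ks)"
    using Suc.prems m by (intro Suc.IH) (auto simp: det_smult)
  also have "power_product n (F (2 * m) # F (2 * m + 1) # rest) (- 1 # 1 # ks) =
      (rat_of_int (b m) / rat_of_int (a m)) \<cdot>\<^sub>m power_product n rest ks"
    unfolding power_product_Cons m(5,6) by (rule smult_inverse_pair[OF m(1-4) rest])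
  finally show ?case by (intro eq_matI) auto
qed

lemma det_mod_cong:
  fixes A B :: "int mat"
  assumes A: "A \<in> carrier_mat n n" and B: "B \<in> carrier_mat n n"
    and cong: "\<And>i j. i < n \<Longrightarrow> j < n \<Longrightarrow> A $$ (i, j) mod Q = B $$ (i, j) mod Q"
  shows "det A mod Q = det B mod Q"
proof -
  have "(signof p * (\<Prod>i = 0..<n. A $$ (i, p i))) mod Q = (signof p * (\<Prod>i = 0..<n. B $$ (i, p i))) mod Q"
    if p: "p permutes {0..<n}" for p
  proof -
    have pn: "p i < n" if "i < n" for i using permutes_in_image[OF p, of i] that by simp
    have "(\<Prod>i = 0..<n. A $$ (i, p i)) mod Q = (\<Prod>i = 0..<n. A $$ (i, p i) mod Q) mod Q"
      by (rule mod_prod_eq[symmetric])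
    also have "(\<Prod>i = 0..<n. A $$ (i, p i) mod Q) = (\<Prod>i = 0..<n. B $$ (i, p i) mod Q)"
      by (intro prod.cong) (auto simp: cong pn)
    also have "\<dots> mod Q = (\<Prod>i = 0..<n. B $$ (i, p i)) mod Q" by (rule mod_prod_eq)
    finally show ?thesis by (intro mod_mult_cong) auto
  qed
  then have "(\<Sum>p | p permutes {0..<n}. (signof p * (\<Prod>i = 0..<n. A $$ (i, p i))) mod Q) =
      (\<Sum>p | p permutes {0..<n}. (signof p * (\<Prod>i = 0..<n. B $$ (i, p i))) mod Q)"
    by (intro sum.cong) auto
  from arg_cong[OF this, of "\<lambda>x. x mod Q"] show ?thesis
    unfolding det_def'[OF A] det_def'[OF B] mod_sum_eq .
qed

lemma det_diag_first:
  assumes "n \<ge> 1"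
  shows "det (mat n n (\<lambda>(k, l). if k = l then (if k = 0 then q else 1) else 0)) = (q :: int)"
    (is "det ?D = q")
proof -
  have "det ?D = prod_list (diag_mat ?D)" by (rule det_upper_triangular[of _ n]) auto
  also have "\<dots> = (\<Prod>i\<in>{0..<n}. ?D $$ (i, i))" by (simp add: prod_list_diag_prod)
  also have "\<dots> = (\<Prod>i\<in>{0..<n}. if i = 0 then q else 1)" by (intro prod.cong) auto
  also have "\<dots> = q" using assms by (subst prod.delta) auto
  finally show ?thesis .
qed

lemma sum_even_odd:
  fixes g :: "nat \<Rightarrow> 'a :: comm_monoid_add"
  shows "sum g {..<2 * m} = (\<Sum>i<m. g (2 * i) + g (2 * i + 1))"
  by (induction m) (simp_all add: add.assoc)

lemma card_bounded_int_mats_ge: "(2 * m + 1) ^ n\<^sup>2 \<le> card (bounded_int_mats n (real m))"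
proof -
  define T where "T = Pi\<^sub>E ({..<n} \<times> {..<n}) (\<lambda>_. {- int m..int m})"
  have "inj_on (\<lambda>g. mat n n g) T"
  proof (rule inj_onI)
    fix f g assume f: "f \<in> T" and g: "g \<in> T" and eq: "mat n n f = mat n n g"
    show "f = g"
    proof
      fix x :: "nat \<times> nat"
      show "f x = g x"
      proof (cases "x \<in> {..<n} \<times> {..<n}")
        case True
        then obtain i j where x: "x = (i, j)" "i < n" "j < n" by auto
        then show ?thesis using arg_cong[OF eq, of "\<lambda>A. A $$ (i, j)"] by simp
      next
        case False
        then show ?thesis using f g unfolding T_def by (metis PiE_arb)
      qed
    qed
  qed
  moreover have "(\<lambda>g. mat n n g) ` T \<subseteq> bounded_int_mats n (real m)"
  proof (rule image_subsetI)
    fix g assume g: "g \<in> T"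
    have "\<bar>real_of_int (g (i, j))\<bar> \<le> real m" if "i < n" "j < n" for i j
    proof -
      have "g (i, j) \<in> {- int m..int m}" using PiE_mem[OF g[unfolded T_def], of "(i, j)"] that by simp
      then have "\<bar>g (i, j)\<bar> \<le> int m" by auto
      then show ?thesis by linarith
    qed
    then show "mat n n g \<in> bounded_int_mats n (real m)" by (simp add: bounded_int_mats_def)
  qed
  ultimately have "card T \<le> card (bounded_int_mats n (real m))"
    using finite_bounded_int_mats by (rule card_inj_on_le)
  moreover have "card T = (2 * m + 1) ^ n\<^sup>2"
    by (simp add: T_def card_PiE card_cartesian_product power2_eq_square nat_add_distrib nat_mult_distrib)
  ultimately show ?thesis by simp
qed

text \<open>
  For \<open>i < r\<close> the tuple contains the pairs \<open>Z i, p i \<cdot>\<^sub>m Z i\<close>, whose quotients multiply up to the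
  scalar \<open>P\<close>; it ends with \<open>P \<cdot>\<^sub>m 1\<^sub>m n\<close> if \<open>s\<close> is odd and with \<open>P \<cdot>\<^sub>m Z r, Z r\<close> if \<open>s\<close> is even.
  Modulo \<open>Q\<close> every \<open>Z i\<close> is \<open>diag(q i, 1, \<dots>, 1)\<close>, so the prime \<open>q j\<close> divides exactly
  once the determinant of \<open>Z j\<close> and no other \<open>det (Z i)\<close>.
\<close>

locale paired_tuples =
  fixes n s :: nat and p q :: "nat \<Rightarrow> int"
  assumes n: "n \<ge> 1" and s: "s \<ge> 1"
    and prime_p: "\<And>i. prime (p i)" and prime_q: "\<And>i. prime (q i)"
    and inj_p: "inj p" and inj_q: "inj q" and p_neq_q: "\<And>i j. p i \<noteq> q j"
begin

text \<open>\<open>R\<close> counts all pairs, \<open>r\<close> those with quotient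
  \<open>p i\<close>. They agree for odd \<open>s\<close>; for even \<open>s\<close> the pair with
  index \<open>r = R - 1\<close> is the one that cancels \<open>P\<close>.\<close>

definition r :: nat where "r = (s - 1) div 2"
definition R :: nat where "R = s div 2"
definition P :: int where "P = (\<Prod>i<r. p i)"
text \<open>The squares let a congruence modulo \<open>Q\<close> determine the valuation at
  \<open>q j\<close> exactly, not merely whether it is positive.\<close>

definition Q :: int where "Q = (\<Prod>i<R. (q i)\<^sup>2)"

text \<open>The free parameter \<open>X i\<close> enters multiplied by the constant
  \<open>Q\<close>: it can be recovered from \<open>Z X i\<close>, and the entries grow only by a
  constant factor.\<close>

definition Z :: "(nat \<Rightarrow> int mat) \<Rightarrow> nat \<Rightarrow> int mat" where
  "Z X i = mat n n (\<lambda>(k, l). (if k = l then (if k = 0 then q i else 1) else 0) + Q * X i $$ (k, l))"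

definition a :: "nat \<Rightarrow> int" where "a i = (if i < r then 1 else P)"
definition b :: "nat \<Rightarrow> int" where "b i = (if i < r then p i else 1)"

definition entry :: "(nat \<Rightarrow> int mat) \<Rightarrow> nat \<Rightarrow> int mat" where
  "entry X i = (if i < 2 * R then (if even i then a (i div 2) else b (i div 2)) \<cdot>\<^sub>m Z X (i div 2)
     else P \<cdot>\<^sub>m 1\<^sub>m n)"

definition tuple :: "(nat \<Rightarrow> int mat) \<Rightarrow> int mat list" where
  "tuple X = map (entry X) [0..<s]"

lemma prime_elem_p: "prime_elem (p i)" and prime_elem_q: "prime_elem (q i)"
  using prime_imp_prime_elem[OF prime_p] prime_imp_prime_elem[OF prime_q] by simp_all

lemma p_ge: "p i \<ge> 1" and q_ge: "q i \<ge> 1"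
  using prime_gt_0_int[OF prime_p[of i]] prime_gt_0_int[OF prime_q[of i]] by linarith+

lemma P_ge: "P \<ge> 1" and Q_ge: "Q \<ge> 1"
  unfolding P_def Q_def using p_ge q_ge by (auto intro!: prod_ge_1)

lemma p_le_P: "i < r \<Longrightarrow> p i \<le> P"
  unfolding P_def using P_ge[unfolded P_def] by (intro zdvd_imp_le dvd_prodI) auto

lemma q_sq_dvd_Q: "i < R \<Longrightarrow> (q i)\<^sup>2 dvd Q"
  unfolding Q_def by (rule dvd_prodI) auto

lemma q_le_Q: "i < R \<Longrightarrow> q i \<le> Q"
  using Q_ge q_sq_dvd_Q[of i] by (intro zdvd_imp_le) (auto simp: power2_eq_square intro: dvd_mult_left)

lemma s_cases: "(odd s \<and> s = 2 * R + 1 \<and> r = R) \<or> (even s \<and> s = 2 * R \<and> R = r + 1)"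
  using s unfolding r_def R_def by (cases "even s") (auto elim!: evenE oddE)

lemma a_nz: "a i \<noteq> 0" and b_nz: "b i \<noteq> 0"
  using P_ge p_ge[of i] by (auto simp: a_def b_def)

lemma Z_carrier [simp]: "Z X i \<in> carrier_mat n n" "dim_row (Z X i) = n" "dim_col (Z X i) = n"
  by (simp_all add: Z_def)

section \<open>Valuations of the determinants in the constructed tuples\<close>

lemma det_Z_mod: "det (Z X i) mod Q = q i mod Q"
proof -
  have "det (Z X i) mod Q = det (mat n n (\<lambda>(k, l). if k = l then (if k = 0 then q i else 1) else 0)) mod Q"
    by (intro det_mod_cong[of _ n]) (auto simp: Z_def)
  then show ?thesis using det_diag_first[OF n] by simp
qed

text \<open>A divisor of \<open>Q\<close> divides \<open>det (Z X i)\<close> if and only if it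
  divides \<open>q i\<close>; this is applied to \<open>q j\<close> and to its square.\<close>

lemma multiplicity_det_Z:
  assumes i: "i < R" and j: "j < R"
  shows "multiplicity (q j) (det (Z X i)) = (if i = j then 1 else 0)"
proof -
  have Qd: "Q dvd det (Z X i) - q i" using det_Z_mod by (simp add: mod_eq_dvd_iff)
  have dvd: "c dvd det (Z X i) \<longleftrightarrow> c dvd q i" if "c dvd Q" for c
    using dvd_trans[OF that Qd] by (metis diff_add_cancel dvd_add_right_iff)
  show ?thesis
  proof (cases "i = j")
    case True
    have "\<not> (q j)\<^sup>2 dvd q j"
    proof
      assume "(q j)\<^sup>2 dvd q j"
      then have "q j * q j dvd q j * 1" by (simp add: power2_eq_square)
      then have "q j dvd 1" using q_ge[of j] by (subst (asm) dvd_mult_cancel_left) auto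
      then show False using prime_q[of j] not_prime_unit by blast
    qed
    then have "\<not> (q j)\<^sup>2 dvd det (Z X i)" using dvd[OF q_sq_dvd_Q[OF j]] True by simp
    moreover have "q j dvd det (Z X i)"
      using dvd[of "q j"] q_sq_dvd_Q[OF j] True by (simp add: power2_eq_square dvd_mult_left)
    ultimately show ?thesis using True by (intro multiplicity_eqI) (auto simp: power2_eq_square)
  next
    case False
    then have "q i \<noteq> q j" using inj_q by (auto dest: injD)
    then have "\<not> q j dvd q i" using primes_dvd_imp_eq[OF prime_q prime_q] by metis
    then have "\<not> q j dvd det (Z X i)"
      using dvd[of "q j"] q_sq_dvd_Q[OF j] by (simp add: power2_eq_square dvd_mult_left)
    then show ?thesis using False by (simp add: not_dvd_imp_multiplicity_0)
  qed
qed

text \<open>The valuation at \<open>q i\<close> is 1, whereas the multiplicity of a prime in 0 is 0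
  by convention.\<close>

lemma det_Z_nz: "i < R \<Longrightarrow> det (Z X i) \<noteq> 0"
  using multiplicity_det_Z[of i i X] by auto

lemma multiplicity_q_p: "multiplicity (q j) (p i) = 0"
  using prime_multiplicity_other[OF prime_q prime_p] p_neq_q by metis

lemma multiplicity_p_p: "multiplicity (p j) (p i) = (if i = j then 1 else 0)"
proof (cases "i = j")
  case True
  then show ?thesis using prime_elem_p[of i] by (simp add: multiplicity_prime)
next
  case False
  then have "p j \<noteq> p i" using inj_p by (auto dest: injD)
  then show ?thesis using False prime_multiplicity_other[OF prime_p prime_p] by metis
qed

lemma multiplicity_P:
  assumes "prime_elem t"
  shows "multiplicity t P = (\<Sum>i<r. multiplicity t (p i))"
  unfolding P_def using p_ge
  by (intro prime_elem_multiplicity_prod_distrib[OF assms]) (auto, metis not_one_le_zero)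

lemma multiplicity_q_P: "multiplicity (q j) P = 0"
  by (simp add: multiplicity_P[OF prime_elem_q] multiplicity_q_p)

lemma multiplicity_p_P: "j < r \<Longrightarrow> multiplicity (p j) P = 1"
  by (simp add: multiplicity_P[OF prime_elem_p] multiplicity_p_p)

lemma entry_even: "i < R \<Longrightarrow> entry X (2 * i) = a i \<cdot>\<^sub>m Z X i"
  and entry_odd: "i < R \<Longrightarrow> entry X (2 * i + 1) = b i \<cdot>\<^sub>m Z X i"
  by (auto simp: entry_def)

lemma entry_nonsingular: "entry X i \<in> carrier_mat n n \<and> det (entry X i) \<noteq> 0"
proof (cases "i < 2 * R")
  case True
  then have "i div 2 < R" by auto
  then show ?thesis using True a_nz b_nz det_Z_nz by (auto simp: entry_def det_smult)
next
  case False
  then show ?thesis using P_ge by (auto simp: entry_def det_smult)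
qed

lemma multiplicity_det_smult:
  assumes "prime_elem t" "c \<noteq> 0" "A \<in> carrier_mat n n" "det A \<noteq> 0"
  shows "multiplicity t (det (c \<cdot>\<^sub>m A)) = n * multiplicity t c + multiplicity t (det A)"
  using assms(2-4)
  by (simp add: det_smult prime_elem_multiplicity_mult_distrib[OF assms(1)]
      prime_elem_multiplicity_power_distrib[OF assms(1)])

text \<open>With exponents \<open>-1, 1, -1, ...\<close> the pairs below \<open>r\<close> contribute
  the scalars \<open>p i\<close>, hence \<open>P\<close> in total. The next pair, or the single last
  matrix at the even position \<open>2 * R\<close>, contributes \<open>1 / P\<close>.\<close>

lemma tuple_relation:
  "power_product n (tuple X) (map (\<lambda>i. if even i then - 1 else 1) [0..<s]) = 1\<^sub>m n"
proof -
  let ?sg = "\<lambda>i :: nat. if even i then - 1 else 1 :: int"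
  have pairs: "power_product n (map (entry X) [0..<2 * R] @ rest) (map ?sg [0..<2 * R] @ ks) =
      (\<Prod>i<R. rat_of_int (b i) / rat_of_int (a i)) \<cdot>\<^sub>m power_product n rest ks"
    if "length rest = length ks" "\<And>A. A \<in> set rest \<Longrightarrow> A \<in> carrier_mat n n \<and> det A \<noteq> 0" for rest ks
    using that det_Z_nz a_nz b_nz entry_even entry_odd
    by (intro power_product_pairs[of R "Z X"]) auto
  have P0: "rat_of_int P \<noteq> 0" using P_ge by simp
  have prod: "(\<Prod>i<r. rat_of_int (b i) / rat_of_int (a i)) = rat_of_int P"
    by (simp add: a_def b_def P_def)
  from s_cases show ?thesis
  proof
    assume odd: "odd s \<and> s = 2 * R + 1 \<and> r = R"
    then have "s = Suc (2 * R)" by simp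
    from arg_cong[OF this, of "\<lambda>m. [0..<m]"] have up: "[0..<s] = [0..<2 * R] @ [2 * R]" by simp
    have last: "entry X (2 * R) = P \<cdot>\<^sub>m 1\<^sub>m n" by (simp add: entry_def)
    have one: "(1\<^sub>m n :: rat mat) \<in> carrier_mat n n" by simp
    interpret group "GL_rat n" by (rule group_GL_rat)
    have idm: "map_mat rat_of_int (1 \<cdot>\<^sub>m 1\<^sub>m n) = 1\<^sub>m n" by (intro eq_matI) auto
    have onec: "1\<^sub>m n \<in> carrier (GL_rat n)" using one_closed by simp
    have o1: "(1\<^sub>m n :: rat mat) [^]\<^bsub>GL_rat n\<^esub> (1 :: int) = 1\<^sub>m n" using int_pow_1[OF onec] .
    \<comment> \<open>The single last matrix is treated as a pair
      \<open>P \<cdot>\<^sub>m 1\<^sub>m n, 1 \<cdot>\<^sub>m 1\<^sub>m n\<close> whose second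
      member is the identity.\<close>
    have "map_mat rat_of_int (P \<cdot>\<^sub>m 1\<^sub>m n) [^]\<^bsub>GL_rat n\<^esub> (- 1 :: int) \<otimes>\<^bsub>GL_rat n\<^esub> 1\<^sub>m n =
        (1 / rat_of_int P) \<cdot>\<^sub>m 1\<^sub>m n"
      using smult_inverse_pair[of "1\<^sub>m n" n P 1 "1\<^sub>m n"] P0 one unfolding idm o1 by simp
    then have tail: "power_product n [entry X (2 * R)] [- 1] = (1 / rat_of_int P) \<cdot>\<^sub>m 1\<^sub>m n"
      unfolding power_product_Cons power_product_Nil last by simp
    have "power_product n (tuple X) (map ?sg [0..<s]) =
        rat_of_int P \<cdot>\<^sub>m power_product n [entry X (2 * R)] [- 1]"
      using pairs[of "[entry X (2 * R)]" "[- 1]"] entry_nonsingular[of X "2 * R"] prod odd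
      unfolding tuple_def up by simp
    also have "\<dots> = 1\<^sub>m n" unfolding tail using P0 by (intro eq_matI) auto
    finally show ?thesis .
  next
    assume even: "even s \<and> s = 2 * R \<and> R = r + 1"
    then have "s = 2 * R" and Rr: "R = Suc r" by auto
    from arg_cong[OF this(1), of "\<lambda>m. [0..<m]"] have up: "[0..<s] = [0..<2 * R]" .
    have "(\<Prod>i<R. rat_of_int (b i) / rat_of_int (a i)) = 1"
      unfolding Rr using prod P0 by (simp add: a_def b_def)
    then have "power_product n (tuple X) (map ?sg [0..<s]) = 1 \<cdot>\<^sub>m 1\<^sub>m n"
      using pairs[of "[]" "[]"] unfolding tuple_def up by simp
    also have "\<dots> = 1\<^sub>m n" by (intro eq_matI) auto
    finally show ?thesis .
  qed
qed

lemma mult_dependent_tuple: "mult_dependent n (tuple X)"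
proof -
  have "\<exists>k\<in>set (map (\<lambda>i. if even i then - 1 else 1 :: int) [0..<s]). k \<noteq> 0"
    using s by (intro bexI[of _ "- 1"]) (auto intro!: image_eqI[of _ _ 0])
  then show ?thesis
    unfolding mult_dependent_def using tuple_relation[of X] unfolding power_product_def
    by (intro exI[of _ "map (\<lambda>i. if even i then - 1 else 1) [0..<s]"]) (simp add: tuple_def)
qed

text \<open>Separates the part of the \<open>det (Z X i)\<close> from that of the scalars: at
  \<open>q j\<close> the scalars have valuation 0, and at \<open>p j\<close> the first sum drops out
  once the two exponents of each pair are known to be opposite.\<close>

lemma valuation_expand:
  assumes t: "prime_elem t"
  shows "(\<Sum>i<s. K i * int (multiplicity t (det (entry X i)))) =
    (\<Sum>i<R. (K (2 * i) + K (2 * i + 1)) * int (multiplicity t (det (Z X i)))) +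
    int n * (\<Sum>i<R. K (2 * i) * int (multiplicity t (a i)) + K (2 * i + 1) * int (multiplicity t (b i))) +
    (if odd s then int n * (K (2 * R) * int (multiplicity t P)) else 0)"
proof -
  let ?g = "\<lambda>i. K i * int (multiplicity t (det (entry X i)))"
  have m_even: "multiplicity t (det (entry X (2 * i))) = n * multiplicity t (a i) + multiplicity t (det (Z X i))"
    if "i < R" for i
    unfolding entry_even[OF that] by (rule multiplicity_det_smult[OF t a_nz Z_carrier(1) det_Z_nz[OF that]])
  have m_odd: "multiplicity t (det (entry X (2 * i + 1))) = n * multiplicity t (b i) + multiplicity t (det (Z X i))"
    if "i < R" for i
    unfolding entry_odd[OF that] by (rule multiplicity_det_smult[OF t b_nz Z_carrier(1) det_Z_nz[OF that]])
  have "sum ?g {..<2 * R} = (\<Sum>i<R. (K (2 * i) + K (2 * i + 1)) * int (multiplicity t (det (Z X i))) +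
      int n * (K (2 * i) * int (multiplicity t (a i)) + K (2 * i + 1) * int (multiplicity t (b i))))"
    unfolding sum_even_odd
  proof (rule sum.cong[OF refl])
    fix i assume "i \<in> {..<R}"
    then have i: "i < R" by simp
    show "?g (2 * i) + ?g (2 * i + 1) = (K (2 * i) + K (2 * i + 1)) * int (multiplicity t (det (Z X i))) +
      int n * (K (2 * i) * int (multiplicity t (a i)) + K (2 * i + 1) * int (multiplicity t (b i)))"
      unfolding m_even[OF i] m_odd[OF i] by (simp add: algebra_simps)
  qed
  also have "\<dots> = (\<Sum>i<R. (K (2 * i) + K (2 * i + 1)) * int (multiplicity t (det (Z X i)))) +
      int n * (\<Sum>i<R. K (2 * i) * int (multiplicity t (a i)) + K (2 * i + 1) * int (multiplicity t (b i)))"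
    by (subst sum.distrib) (simp only: sum_distrib_left)
  finally have pairs: "sum ?g {..<2 * R} = \<dots>" .
  from s_cases show ?thesis
  proof
    assume odd: "odd s \<and> s = 2 * R + 1 \<and> r = R"
    then have "s = Suc (2 * R)" by simp
    from arg_cong[OF this, of "\<lambda>m. sum ?g {..<m}"]
    have "sum ?g {..<s} = sum ?g {..<2 * R} + ?g (2 * R)" by simp
    moreover have "multiplicity t (det (entry X (2 * R))) = n * multiplicity t P"
      using multiplicity_det_smult[OF t, of P "1\<^sub>m n"] P_ge by (simp add: entry_def)
    ultimately show ?thesis using pairs odd by (simp add: mult_ac)
  next
    assume even: "even s \<and> s = 2 * R \<and> R = r + 1"
    then have "s = 2 * R" by simp
    from arg_cong[OF this, of "\<lambda>m. sum ?g {..<m}"] show ?thesis using pairs even by simp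
  qed
qed

text \<open>The solutions of the valuation equations are multiples of the alternating vector.
  Position \<open>2 * r\<close> carries the scalar \<open>P\<close> for either parity of
  \<open>s\<close>, so its exponent serves as the reference value.\<close>

lemma relation_alternates:
  assumes rel: "\<And>t. prime t \<Longrightarrow> (\<Sum>i<s. K i * int (multiplicity t (det (entry X i)))) = 0"
    and i: "i < s"
  shows "K i = (if even i then K (2 * r) else - K (2 * r))"
proof -
  have q: "K (2 * j) + K (2 * j + 1) = 0" if j: "j < R" for j
  proof -
    have ab: "multiplicity (q j) (a i) = 0" "multiplicity (q j) (b i) = 0" for i
      by (auto simp: a_def b_def multiplicity_q_P multiplicity_q_p)
    have "(\<Sum>i<R. (K (2 * i) + K (2 * i + 1)) * int (multiplicity (q j) (det (Z X i)))) = 0"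
      using rel[OF prime_q[of j]] unfolding valuation_expand[OF prime_elem_q] ab multiplicity_q_P by (simp split: if_splits)
    moreover have "(\<Sum>i<R. (K (2 * i) + K (2 * i + 1)) * int (multiplicity (q j) (det (Z X i)))) =
        (\<Sum>i<R. if i = j then K (2 * i) + K (2 * i + 1) else 0)"
      using j by (intro sum.cong) (auto simp: multiplicity_det_Z)
    ultimately show ?thesis using j by simp
  qed
  have p: "K (2 * j + 1) = - K (2 * r)" if j: "j < r" for j
  proof -
    let ?f = "\<lambda>i. K (2 * i) * int (multiplicity (p j) (a i)) + K (2 * i + 1) * int (multiplicity (p j) (b i))"
    \<comment> \<open>Nothing is known about the valuations of \<open>det (Z X i)\<close> at
      \<open>p j\<close>, but their coefficients vanish by the equations at the
      \<open>q j\<close>.\<close>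
    have "(\<Sum>i<R. (K (2 * i) + K (2 * i + 1)) * int (multiplicity (p j) (det (Z X i)))) = 0"
      using q by (intro sum.neutral) auto
    then have 0: "int n * sum ?f {..<R} + (if odd s then int n * K (2 * R) else 0) = 0"
      using rel[OF prime_p[of j]] unfolding valuation_expand[OF prime_elem_p] multiplicity_p_P[OF j] by (simp split: if_splits)
    have "sum ?f {..<r} = (\<Sum>i<r. if i = j then K (2 * i + 1) else 0)"
      by (intro sum.cong) (auto simp: a_def b_def multiplicity_p_p)
    then have fr: "sum ?f {..<r} = K (2 * j + 1)" using j by simp
    have "int n * (K (2 * j + 1) + K (2 * r)) = 0"
      using s_cases
    proof
      assume "odd s \<and> s = 2 * R + 1 \<and> r = R"
      then show ?thesis using 0 fr by (simp add: algebra_simps)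
    next
      assume even: "even s \<and> s = 2 * R \<and> R = r + 1"
      then have "sum ?f {..<R} = sum ?f {..<r} + ?f r" by simp
      also have "?f r = K (2 * r)" using multiplicity_p_P[OF j] by (simp add: a_def b_def)
      finally show ?thesis using 0 fr even by (simp add: algebra_simps)
    qed
    then show ?thesis using n by simp
  qed
  have i2: "i = 2 * (i div 2) \<or> i = 2 * (i div 2) + 1" by presburger
  show ?thesis
  proof (cases "i div 2 < r")
    case True
    then have "i div 2 < R" using s_cases by auto
    then show ?thesis using i2 p[OF True] q[of "i div 2"] by (cases "even i") auto
  next
    case False
    then have "i = 2 * r \<or> i = 2 * r + 1 \<and> r < R" using s_cases i by auto
    then show ?thesis using q[of r] by auto
  qed
qed

text \<open>A proper sub-tuple has exponent 0 at some position, and all exponents agree up to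
  sign.\<close>

lemma not_mult_dependent_subtuple:
  assumes I: "I \<subset> {..<s}"
  shows "\<not> mult_dependent n (nths (tuple X) I)"
proof
  assume dep: "mult_dependent n (nths (tuple X) I)"
  have nonsing: "\<And>A. A \<in> set (tuple X) \<Longrightarrow> A \<in> carrier_mat n n \<and> det A \<noteq> 0"
    using entry_nonsingular by (auto simp: tuple_def)
  show False
  proof (rule mult_dependent_valuation[OF dep nonsing])
    fix K i
    assume K: "i < length (tuple X)" "K i \<noteq> 0" "\<And>i. i \<notin> I \<Longrightarrow> K i = 0"
      "\<And>t. prime t \<Longrightarrow> (\<Sum>i<length (tuple X). K i * int (multiplicity t (det (tuple X ! i)))) = 0"
    have rel: "(\<Sum>i<s. K i * int (multiplicity t (det (entry X i)))) = 0" if "prime t" for t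
      using K(4)[OF that] by (simp add: tuple_def)
    obtain j where j: "j < s" "j \<notin> I" using I by auto
    then have "K (2 * r) = 0"
      using K(3)[OF j(2)] relation_alternates[OF rel j(1)] by (auto split: if_splits)
    then have "K i = 0" using relation_alternates[OF rel, of i] K(1) by (simp add: tuple_def)
    then show False using K(2) by simp
  qed
qed

lemma entry_bounded:
  assumes X: "\<And>i. i < R \<Longrightarrow> X i \<in> bounded_int_mats n (real m)"
    and H: "real_of_int (P * Q) * (real m + 1) \<le> H"
  shows "entry X i \<in> bounded_int_mats n H"
proof -
  have "\<bar>entry X i $$ (k, l)\<bar> \<le> P * Q * (int m + 1)" if kl: "k < n" "l < n" for k l
  proof (cases "i < 2 * R")
    case True
    define j where "j = i div 2"
    have j: "j < R" using True by (auto simp: j_def)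
    define c where "c = (if even i then a j else b j)"
    have c: "\<bar>c\<bar> \<le> P" using P_ge p_le_P[of j] p_ge[of j] by (auto simp: c_def a_def b_def)
    have "\<bar>Q * X j $$ (k, l)\<bar> \<le> Q * int m"
      using Q_ge bounded_int_mats_abs_le[OF X[OF j] kl] by (simp add: abs_mult)
    moreover have "\<bar>if k = l then (if k = 0 then q j else 1) else 0\<bar> \<le> Q"
      using q_le_Q[OF j] q_ge[of j] Q_ge by auto
    ultimately have "\<bar>Z X j $$ (k, l)\<bar> \<le> Q + Q * int m"
      using kl unfolding Z_def by simp
    then have "\<bar>c * Z X j $$ (k, l)\<bar> \<le> P * (Q + Q * int m)"
      unfolding abs_mult using c P_ge by (intro mult_mono) auto
    moreover have "entry X i $$ (k, l) = c * Z X j $$ (k, l)"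
      using True kl by (auto simp: entry_def c_def j_def)
    ultimately show ?thesis by (simp add: algebra_simps)
  next
    case False
    then have "\<bar>entry X i $$ (k, l)\<bar> \<le> P" using kl P_ge by (simp add: entry_def)
    also have "P = P * 1 * 1" by simp
    also have "\<dots> \<le> P * Q * (int m + 1)" using P_ge Q_ge by (intro mult_mono) auto
    finally show ?thesis .
  qed
  then have "\<bar>real_of_int (entry X i $$ (k, l))\<bar> \<le> H" if "k < n" "l < n" for k l
  proof -
    have "real_of_int \<bar>entry X i $$ (k, l)\<bar> \<le> real_of_int (P * Q * (int m + 1))"
      using \<open>\<And>k l. k < n \<Longrightarrow> l < n \<Longrightarrow> \<bar>entry X i $$ (k, l)\<bar> \<le> P * Q * (int m + 1)\<close>[OF that]
      unfolding of_int_le_iff .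
    then show ?thesis using H by simp
  qed
  then show ?thesis using entry_nonsingular[of X i] by (auto simp: bounded_int_mats_def)
qed

lemma card_minimal_dependent_tuples_ge:
  assumes H: "real_of_int (P * Q) * (real m + 1) \<le> H"
    and fin: "finite (minimal_dependent_tuples n s H)"
  shows "(2 * m + 1) ^ (n\<^sup>2 * R) \<le> card (minimal_dependent_tuples n s H)"
proof -
  define T where "T = Pi\<^sub>E {..<R} (\<lambda>_. bounded_int_mats n (real m))"
  have inj: "inj_on tuple T"
  proof (rule inj_onI)
    fix X Y assume X: "X \<in> T" and Y: "Y \<in> T" and eq: "tuple X = tuple Y"
    show "X = Y"
    proof
      fix i
      show "X i = Y i"
      proof (cases "i < R")
        case True
        have "2 * i < s" using True s_cases by auto
        then have "entry X (2 * i) = entry Y (2 * i)"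
          using arg_cong[OF eq, of "\<lambda>xs. xs ! (2 * i)"] by (simp add: tuple_def)
        then have aZ: "a i \<cdot>\<^sub>m Z X i = a i \<cdot>\<^sub>m Z Y i" unfolding entry_even[OF True] .
        have Xi: "X i \<in> carrier_mat n n" "Y i \<in> carrier_mat n n"
          using PiE_mem[OF X[unfolded T_def], of i] PiE_mem[OF Y[unfolded T_def], of i] True
          by (auto simp: bounded_int_mats_def)
        show ?thesis
        proof (rule eq_matI)
          fix k l assume "k < dim_row (Y i)" "l < dim_col (Y i)"
          then have kl: "k < n" "l < n" using Xi by auto
          have "a i * Z X i $$ (k, l) = a i * Z Y i $$ (k, l)"
            using arg_cong[OF aZ, of "\<lambda>A. A $$ (k, l)"] kl by simp
          then have "Z X i $$ (k, l) = Z Y i $$ (k, l)" using a_nz[of i] by simp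
          then show "X i $$ (k, l) = Y i $$ (k, l)" using kl Q_ge by (simp add: Z_def)
        qed (use Xi in auto)
      next
        case False
        then show ?thesis
          using PiE_arb[OF X[unfolded T_def], of i] PiE_arb[OF Y[unfolded T_def], of i] by simp
      qed
    qed
  qed
  have img: "tuple ` T \<subseteq> minimal_dependent_tuples n s H"
  proof (rule image_subsetI)
    fix X assume X: "X \<in> T"
    have "X i \<in> bounded_int_mats n (real m)" if "i < R" for i
      using PiE_mem[OF X[unfolded T_def], of i] that by simp
    then have "entry X i \<in> bounded_int_mats n H" for i by (rule entry_bounded[OF _ H])
    then show "tuple X \<in> minimal_dependent_tuples n s H"
      using mult_dependent_tuple[of X] not_mult_dependent_subtuple[of _ X] entry_nonsingular[of X]
      unfolding minimal_dependent_tuples_def dependent_tuples_def by (auto simp: tuple_def)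
  qed
  have "(2 * m + 1) ^ (n\<^sup>2 * R) \<le> card (bounded_int_mats n (real m)) ^ R"
    unfolding power_mult using card_bounded_int_mats_ge by (rule power_mono) simp
  also have "\<dots> = card T" by (simp add: T_def card_PiE)
  also have "\<dots> \<le> card (minimal_dependent_tuples n s H)" by (rule card_inj_on_le[OF inj img fin])
  finally show ?thesis .
qed

end

section \<open>Passage to real \<open>H\<close> and the asymptotic bounds\<close>

lemma minimal_dependent_tuples_floor:
  assumes "H \<ge> 0"
  shows "minimal_dependent_tuples n s (real (nat \<lfloor>H\<rfloor>)) = minimal_dependent_tuples n s H"
  using bounded_int_mats_floor[OF assms]
  by (simp add: minimal_dependent_tuples_def dependent_tuples_def)

lemma finite_minimal_dependent_tuples:
  assumes "H \<ge> 0"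
  shows "finite (minimal_dependent_tuples n s H)"
proof (rule finite_subset)
  show "minimal_dependent_tuples n s H \<subseteq> {As. set As \<subseteq> bounded_int_mats n H \<and> length As = s}"
    by (auto simp: minimal_dependent_tuples_def dependent_tuples_def)
  show "finite {As. set As \<subseteq> bounded_int_mats n H \<and> length As = s}"
    using finite_bounded_int_mats[of n "nat \<lfloor>H\<rfloor>"] bounded_int_mats_floor[OF assms]
    by (intro finite_lists_length_eq) simp
qed

lemma eventually_le_powr:
  fixes K d :: real
  assumes d: "d > 0"
  shows "\<forall>\<^sub>F H in at_top. K \<le> H powr d"
proof (rule eventually_mono[OF eventually_ge_at_top])
  fix H assume "max 1 K powr (1 / d) \<le> H"
  then have "(max 1 K powr (1 / d)) powr d \<le> H powr d" using d by (intro powr_mono2) auto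
  then show "K \<le> H powr d" using d by (simp add: powr_powr)
qed

lemma exists_prime_sequences:
  obtains p q :: "nat \<Rightarrow> int" where "\<And>i. prime (p i)" "\<And>i. prime (q i)" "inj p" "inj q" "\<And>i j. p i \<noteq> q j"
proof -
  obtain f :: "nat \<Rightarrow> nat" where f: "inj f" "range f \<subseteq> {p. prime p}"
    using infinite_countable_subset[OF primes_infinite] by blast
  show ?thesis
  proof (rule that[of "\<lambda>i. int (f (2 * i))" "\<lambda>i. int (f (2 * i + 1))"])
    show "prime (int (f (2 * i)))" "prime (int (f (2 * i + 1)))" for i using f(2) by auto
    show "inj (\<lambda>i. int (f (2 * i)))" "inj (\<lambda>i. int (f (2 * i + 1)))"
      using injD[OF f(1)] by (fastforce intro: injI)+
    show "int (f (2 * i)) \<noteq> int (f (2 * j + 1))" for i j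
    proof
      assume "int (f (2 * i)) = int (f (2 * j + 1))"
      then have "2 * i = 2 * j + 1" using injD[OF f(1)] by simp
      then show False by presburger
    qed
  qed
qed

lemma minimal_dependent_tuples_upper:
  fixes \<epsilon> :: real
  assumes n: "n \<ge> 1" and s: "s \<ge> 1" and \<epsilon>: "\<epsilon> > 0"
  shows "\<forall>\<^sub>F H in at_top. real (card (minimal_dependent_tuples n s H)) \<le>
    H powr (real s * (real n)\<^sup>2 - real_of_int \<lceil>real s / 2\<rceil> * real n + \<epsilon>)"
proof -
  define E where "E = real s * (real n)\<^sup>2 - real_of_int \<lceil>real s / 2\<rceil> * real n"
  \<comment> \<open>Half of \<open>\<epsilon>\<close> is spent on the \<open>s\<close> small losses,
    the other half absorbs the constant \<open>C\<close>.\<close>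
  have se: "real s * (\<epsilon> / (2 * real s)) = \<epsilon> / 2" using s by simp
  obtain C where C: "C > 0" "\<And>h. h \<ge> 1 \<Longrightarrow>
    real (card (minimal_dependent_tuples n s (real h))) \<le> C * real h powr (E + \<epsilon> / 2)"
    using card_minimal_dependent_tuples_le[of "\<epsilon> / (2 * real s)" n s] n s \<epsilon> 
    unfolding se E_def[symmetric] by auto
  \<comment> \<open>Non-negativity of the exponent is needed to replace
    \<open>h = \<lfloor>H\<rfloor>\<close> by the larger \<open>H\<close>.\<close>
  have "real_of_int \<lceil>real s / 2\<rceil> * real n \<le> real s * (real n)\<^sup>2"
  proof (intro mult_mono)
    show "real_of_int \<lceil>real s / 2\<rceil> \<le> real s" using ceiling_half_le[of 0 s] by simp
    show "real n \<le> (real n)\<^sup>2" using n by (simp add: power2_eq_square)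
  qed auto
  then have E: "E \<ge> 0" by (simp add: E_def)
  have "\<forall>\<^sub>F H in at_top. C \<le> H powr (\<epsilon> / 2)" using \<epsilon> by (intro eventually_le_powr) simp
  then have "\<forall>\<^sub>F H in at_top. real (card (minimal_dependent_tuples n s H)) \<le> H powr (E + \<epsilon>)"
    using eventually_ge_at_top[of 1]
  proof eventually_elim
    case (elim H)
    define h where "h = nat \<lfloor>H\<rfloor>"
    have h: "h \<ge> 1" "real h \<le> H" using elim(2) unfolding h_def by linarith+
    have "real (card (minimal_dependent_tuples n s H)) \<le> C * real h powr (E + \<epsilon> / 2)"
      using C(2)[OF h(1)] minimal_dependent_tuples_floor[of H n s] elim(2) by (simp add: h_def)
    also have "\<dots> \<le> H powr (\<epsilon> / 2) * H powr (E + \<epsilon> / 2)"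
      using elim h E \<epsilon> C(1) by (intro mult_mono powr_mono2) auto
    also have "\<dots> = H powr (E + \<epsilon>)" by (simp add: powr_add[symmetric] add.commute)
    finally show ?case .
  qed
  then show ?thesis by (simp add: E_def)
qed

text \<open>The exponent counts \<open>s div 2\<close> free matrices with \<open>n\<^sup>2\<close>
  entries each; the constant \<open>P * Q\<close> is absorbed by
  \<open>H powr \<epsilon>\<close>.\<close>

lemma minimal_dependent_tuples_lower:
  fixes \<epsilon> :: real
  assumes n: "n \<ge> 1" and s: "s \<ge> 1" and \<epsilon>: "\<epsilon> > 0"
  shows "\<forall>\<^sub>F H in at_top. H powr (real (n\<^sup>2 * (s div 2)) - \<epsilon>) \<le> real (card (minimal_dependent_tuples n s H))"
proof -
  obtain p q :: "nat \<Rightarrow> int" where pq: "\<And>i. prime (p i)" "\<And>i. prime (q i)" "inj p" "inj q" "\<And>i j. p i \<noteq> q j"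
    using exists_prime_sequences by blast
  interpret paired_tuples n s p q using n s pq by unfold_locales
  define c where "c = real_of_int (P * Q)"
  define N where "N = n\<^sup>2 * (s div 2)"
  have "P * Q \<ge> 1 * 1" using P_ge Q_ge by (intro mult_mono) auto
  then have c: "c \<ge> 1" unfolding c_def by linarith
  have "\<forall>\<^sub>F H in at_top. c ^ N \<le> H powr \<epsilon>" using \<epsilon> by (rule eventually_le_powr)
  then show ?thesis
    using eventually_ge_at_top[of "3 * c"]
  proof eventually_elim
    case (elim H)
    then have H: "H > 0" "3 \<le> H / c" using c by (auto simp: field_simps)
    \<comment> \<open>The largest \<open>m\<close> with \<open>c * (m + 1) \<le> H\<close>, as the
      bound on the entries demands. Since \<open>H \<ge> 3 * c\<close> gives
      \<open>m \<ge> 1\<close>, also \<open>H / c < m + 2 \<le> 2 * m + 1\<close>.\<close>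
    define m where "m = nat \<lfloor>H / c\<rfloor> - 1"
    have "real m + 1 = real_of_int \<lfloor>H / c\<rfloor>" using H(2) unfolding m_def by linarith
    then have m: "real m + 1 \<le> H / c" "H / c < real m + 2" by linarith+
    then have "c * (real m + 1) \<le> H" using c by (simp add: field_simps)
    then have "(2 * m + 1) ^ N \<le> card (minimal_dependent_tuples n s H)"
      using card_minimal_dependent_tuples_ge[of m H] finite_minimal_dependent_tuples[of H n s] H(1)
      by (simp add: c_def N_def R_def)
    then have ge: "real (2 * m + 1) ^ N \<le> real (card (minimal_dependent_tuples n s H))"
      unfolding of_nat_power[symmetric] of_nat_le_iff .
    have "H powr (real N - \<epsilon>) = H powr real N / H powr \<epsilon>" by (rule powr_diff)
    also have "\<dots> \<le> H ^ N / c ^ N"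
      using elim H c by (simp add: powr_realpow frac_le)
    also have "\<dots> = (H / c) ^ N" by (simp add: power_divide)
    also have "\<dots> \<le> real (2 * m + 1) ^ N" using m H by (intro power_mono) auto
    also note ge
    finally show ?case by (simp add: N_def)
  qed
qed

theorem theorem2p5:
  fixes n s :: nat
  assumes "n \<ge> 1" and "s \<ge> 1"
  shows "\<forall>\<epsilon>::real. \<epsilon> > 0 \<longrightarrow>
    (\<forall>\<^sub>F H :: real in at_top.
       real (card (minimal_dependent_tuples n s H))
         \<le> H powr (real s * (real n)^2 - real_of_int \<lceil>real s / 2\<rceil> * real n + \<epsilon>) \<and>
       real (card (minimal_dependent_tuples n s H))
         \<ge> (if even s
            then H powr ((real s - 1) * (real n)^2 / 2 + real n / 2 - \<epsilon>)
            else H powr ((real s - 1) * (real n)^2 / 2 - \<epsilon>)))"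
proof (intro allI impI)
  fix \<epsilon> :: real assume \<epsilon>: "\<epsilon> > 0"
  define F where "F = (if even s then (real s - 1) * (real n)\<^sup>2 / 2 + real n / 2
    else (real s - 1) * (real n)\<^sup>2 / 2)"
  have F: "F \<le> real (n\<^sup>2 * (s div 2))"
  proof (cases "even s")
    case True
    then obtain k where k: "s = 2 * k" by blast
    \<comment> \<open>The margin by which the construction exceeds the required exponent for even
      \<open>s\<close>; for odd \<open>s\<close> the two exponents coincide.\<close>
    define B where "B = ((real n)\<^sup>2 - real n) / 2"
    have "B \<ge> 0" using assms(1) by (simp add: B_def power2_eq_square)
    moreover have "F = real k * (real n)\<^sup>2 - B"
      using True by (simp add: F_def B_def k field_simps)
    ultimately have "F \<le> real k * (real n)\<^sup>2" by linarith
    then show ?thesis by (simp add: k mult.commute)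
  next
    case False
    then obtain k where k: "s = 2 * k + 1" by (rule oddE)
    then show ?thesis by (simp add: F_def)
  qed
  show "\<forall>\<^sub>F H :: real in at_top.
       real (card (minimal_dependent_tuples n s H))
         \<le> H powr (real s * (real n)^2 - real_of_int \<lceil>real s / 2\<rceil> * real n + \<epsilon>) \<and>
       real (card (minimal_dependent_tuples n s H))
         \<ge> (if even s
            then H powr ((real s - 1) * (real n)^2 / 2 + real n / 2 - \<epsilon>)
            else H powr ((real s - 1) * (real n)^2 / 2 - \<epsilon>))"
    using minimal_dependent_tuples_upper[OF assms \<epsilon>] minimal_dependent_tuples_lower[OF assms \<epsilon>]
      eventually_ge_at_top[of 1]
  proof eventually_elim
    case (elim H)
    have "H powr (F - \<epsilon>) \<le> H powr (real (n\<^sup>2 * (s div 2)) - \<epsilon>)"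
      using elim(3) F by (intro powr_mono) auto
    then have "H powr (F - \<epsilon>) \<le> real (card (minimal_dependent_tuples n s H))" using elim(2) by linarith
    then show ?case using elim(1) by (auto simp: F_def)
  qed
qed

end
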